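(* Assume the hardness of the Ring-LWE problem underlying the RNS-CKKS scheme, so that RNS-CKKS is IND-CPA secure (with its public evaluation keys given to the adversary). Consider the client–server inference protocol described in the context. Then a passive polynomial-time attacker with access to all of the server's state cannot distinguish two different plaintext inputs of the client. That is, for every probabilistic polynomial-time attacker $\mathcal{A}$ and all plaintext inputs $x \neq x'$ in $\mathbb{R}^d$ (possibly chosen by $\mathcal{A}$ given the public keys), the quantity $$\bigl|\Pr[\mathcal{A}(\mathrm{View}_S(x)) = 1] - \Pr[\mathcal{A}(\mathrm{View}_S(x')) = 1]\bigr|$$ is negligible in the security parameter, where $\mathrm{View}_S(x)$ denotes the entire state of the server during an honest execution of the protocol in which the client's input is $x$.
   Context: Encryption scheme. RNS-CKKS is a public-key (leveled) fully homomorphic encryption scheme with (randomized) key generation producing a public key $pk$, public evaluation keys, and a secret key $sk$; encryption $\mathrm{Enc}_{pk}\colon \mathbb{R}^M \to \mathcal{C}$ of messages with $M$ slots (fixed-point reals) into a ciphertext space $\mathcal{C}$; decryption $\mathrm{Dec}_{sk}$; and publicly computable polynomial-time homomorphic operations on ciphertexts: slot-wise addition, subtraction and multiplication (ciphertext–ciphertext or ciphertext–plaintext), and cyclic rotation of slots. IND-CPA security means that, for any two messages, no probabilistic polynomial-time adversary given $pk$ and the public evaluation keys can distinguish their encryptions with non-negligible advantage. An input $x\in\mathbb{R}^d$, $d\le M$, is encoded as the message $[x_1,\dots,x_d,0,\dots,0]\in\mathbb{R}^M$. Protocol. (1) The client generates the keys, keeps $sk$, and sends $pk$ and the evaluation keys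 to the server. (2) The client sends the single ciphertext $\mathrm{Enc}_{pk}(x)$ to the server. (3) The server, which holds a neural network and fixed public/server-chosen parameters (all independent of the client input), samples its own random noise independently of the client input and computes, using only the homomorphic operations above applied to the received ciphertext together with its own plaintext data (a fixed polynomial-size circuit), a ciphertext $\mathit{ret}$. (4) The server sends $\mathit{ret}$ (and unencrypted parameters not depending on $x$) to the client, who decrypts $\mathit{ret}$ with $sk$. The client never shares any decrypted value with the server. The server's state consists of $pk$, the evaluation keys, the received ciphertext, the model and parameters, the server's randomness, and all ciphertexts computed by the server, including $\mathit{ret}$. A passive (semi-honest) attacker observes this state (in particular all messages sent over the network between client and server) but does not deviate from the protocol. *)

theory Defs
  imports "HOL-Probability.Probability" "HOL-Computational_Algebra.Polynomial"
begin

section \<open>Probabilistic polynomial time\<close>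

text \<open>
  The machine model is a probabilistic WHILE language over binary trees (S-expressions).
  An assignment is charged the size of the value it stores, so no value can outgrow the
  running time, and the model is polynomially equivalent to probabilistic Turing machines.
\<close>

datatype sexp = Null | Cell sexp sexp

fun car :: "sexp \<Rightarrow> sexp" where
  "car Null = Null"
| "car (Cell a b) = a"

fun cdr :: "sexp \<Rightarrow> sexp" where
  "cdr Null = Null"
| "cdr (Cell a b) = b"

datatype expr = EVar nat | ENull | ECell expr expr | ECar expr | ECdr expr

primrec eval_expr :: "expr \<Rightarrow> (nat \<Rightarrow> sexp) \<Rightarrow> sexp" where
  "eval_expr (EVar x) s = s x"
| "eval_expr ENull s = Null"
| "eval_expr (ECell a b) s = Cell (eval_expr a s) (eval_expr b s)"
| "eval_expr (ECar a) s = car (eval_expr a s)"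
| "eval_expr (ECdr a) s = cdr (eval_expr a s)"

datatype com =
    Assign nat expr
  | Flip nat
  | Seq com com
  | Cond nat com com
  | While nat com

definition sbit :: "bool \<Rightarrow> sexp" where
  "sbit b = (if b then Cell Null Null else Null)"

partial_function (spmf) loop :: "('s \<Rightarrow> bool) \<Rightarrow> ('s \<Rightarrow> 's spmf) \<Rightarrow> 's \<Rightarrow> 's spmf" where
  "loop g f s = (if g s then bind_spmf (f s) (loop g f) else return_spmf s)"

text \<open>
  The second component of the state is the clock.  Mass missing from the resulting
  subdistribution is the probability of divergence.
\<close>

primrec run :: "com \<Rightarrow> (nat \<Rightarrow> sexp) \<times> nat \<Rightarrow> ((nat \<Rightarrow> sexp) \<times> nat) spmf" where
  "run (Assign x e) =
     (\<lambda>(s, t). return_spmf (s(x := eval_expr e s), t + 1 + size (eval_expr e s)))"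
| "run (Flip x) = (\<lambda>(s, t). map_spmf (\<lambda>b. (s(x := sbit b), t + 1)) coin_spmf)"
| "run (Seq c c') = (\<lambda>st. bind_spmf (run c st) (run c'))"
| "run (Cond x c c') = (\<lambda>(s, t). if s x \<noteq> Null then run c (s, t + 1) else run c' (s, t + 1))"
| "run (While x c) = loop (\<lambda>(s, t). s x \<noteq> Null) (\<lambda>(s, t). run c (s, t + 1))"

text \<open>Input and output are in register 0; the time bound holds for all inputs and all coin tosses.\<close>

definition exec :: "com \<Rightarrow> sexp \<Rightarrow> ((nat \<Rightarrow> sexp) \<times> nat) spmf" where
  "exec c x = run c ((\<lambda>_. Null)(0 := x), 0)"

definition result :: "com \<Rightarrow> sexp \<Rightarrow> sexp spmf" where
  "result c x = map_spmf (\<lambda>(s, t). s 0) (exec c x)"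

definition ppt :: "com \<Rightarrow> bool" where
  "ppt c \<longleftrightarrow> (\<exists>p :: nat poly. \<forall>x. lossless_spmf (exec c x) \<and>
     (\<forall>(s, t) \<in> set_spmf (exec c x). t \<le> poly p (size x)))"

definition polytime_computable :: "('a \<Rightarrow> sexp) \<Rightarrow> ('a \<Rightarrow> sexp) \<Rightarrow> bool" where
  "polytime_computable inp f \<longleftrightarrow> (\<exists>c. ppt c \<and> (\<forall>a. result c (inp a) = return_spmf (f a)))"

definition negligible_fun :: "(nat \<Rightarrow> real) \<Rightarrow> bool" where
  "negligible_fun f \<longleftrightarrow> (\<forall>k :: nat. \<forall>\<^sub>F n in sequentially. \<bar>f n\<bar> < 1 / real n ^ k)"


section \<open>Data representation\<close>

definition slist :: "sexp list \<Rightarrow> sexp" where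
  "slist xs = foldr Cell xs Null"

fun unslist :: "sexp \<Rightarrow> sexp list" where
  "unslist Null = []"
| "unslist (Cell a b) = a # unslist b"

definition unary :: "nat \<Rightarrow> sexp" where
  "unary n = slist (replicate n Null)"

definition bits :: "bool list \<Rightarrow> sexp" where
  "bits bs = slist (map sbit bs)"

text \<open>
  Integers are stored as a sign and a little-endian binary magnitude, and fixed-point reals
  with \<open>p\<close> fractional bits as their integer mantissa.  Reading is total: every S-expression
  denotes a vector of fixed-point reals, and every such vector is denoted.
\<close>

fun read_nat :: "sexp \<Rightarrow> nat" where
  "read_nat Null = 0"
| "read_nat (Cell b m) = (if b = Null then 0 else 1) + 2 * read_nat m"

fun read_int :: "sexp \<Rightarrow> int" where
  "read_int Null = 0"
| "read_int (Cell s m) = (if s = Null then 1 else - 1) * int (read_nat m)"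

definition read_vec :: "nat \<Rightarrow> sexp \<Rightarrow> real list" where
  "read_vec p v = map (\<lambda>k. of_int (read_int k) / 2 ^ p) (unslist v)"


section \<open>Public-key homomorphic encryption of real vectors\<close>

datatype arith = Add | Sub | Mul

text \<open>
  The first argument of every field is the security parameter.  \<open>slots\<close> is the number \<open>M\<close> of
  slots, \<open>prec\<close> the number of fractional bits of plaintexts given to the public operations,
  \<open>keygen\<close> returns (public key, evaluation keys, secret key), and vectors in \<open>\<real>\<^sup>M\<close> are lists of
  length \<open>M\<close>.  The homomorphic operations take the evaluation keys: \<open>hom_cc\<close> acts on two
  ciphertexts, \<open>hom_cp\<close> on a ciphertext and a plaintext vector, \<open>hom_rot\<close> rotates by a number
  of slots.
\<close>

record fhe =
  slots :: "nat \<Rightarrow> nat"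
  prec :: "nat \<Rightarrow> nat"
  ctxts :: "nat \<Rightarrow> sexp set"
  keygen :: "nat \<Rightarrow> (sexp \<times> sexp \<times> sexp) pmf"
  enc :: "nat \<Rightarrow> sexp \<Rightarrow> real list \<Rightarrow> sexp pmf"
  dec :: "nat \<Rightarrow> sexp \<Rightarrow> sexp \<Rightarrow> real list"
  hom_cc :: "arith \<Rightarrow> nat \<Rightarrow> sexp \<Rightarrow> sexp \<Rightarrow> sexp \<Rightarrow> sexp"
  hom_cp :: "arith \<Rightarrow> nat \<Rightarrow> sexp \<Rightarrow> sexp \<Rightarrow> real list \<Rightarrow> sexp"
  hom_rot :: "nat \<Rightarrow> sexp \<Rightarrow> sexp \<Rightarrow> nat \<Rightarrow> sexp"

text \<open>
  Keys and ciphertexts have polynomial length, and the public operations are computable in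
  polynomial time.  The operations are total with values in the ciphertext space: applied to
  malformed arguments they return some ciphertext.  (Approximate) correctness of decryption
  plays no role for the confidentiality of the client input and is not demanded.
\<close>

definition fhe_scheme :: "fhe \<Rightarrow> bool" where
  "fhe_scheme S \<longleftrightarrow>
     (\<exists>q :: nat poly. \<forall>n.
        (\<forall>(pk, evk, sk) \<in> set_pmf (keygen S n).
           size pk \<le> poly q n \<and> size evk \<le> poly q n \<and> size sk \<le> poly q n) \<and>
        (\<forall>c \<in> ctxts S n. size c \<le> poly q n)) \<and>
     (\<forall>n. \<forall>(pk, evk, sk) \<in> set_pmf (keygen S n). \<forall>m. length m = slots S n \<longrightarrow>
        set_pmf (enc S n pk m) \<subseteq> ctxts S n) \<and>
     (\<forall>f n evk c c'. hom_cc S f n evk c c' \<in> ctxts S n) \<and>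
     (\<forall>f n evk c v. hom_cp S f n evk c v \<in> ctxts S n) \<and>
     (\<forall>n evk c k. hom_rot S n evk c k \<in> ctxts S n) \<and>
     polytime_computable unary (\<lambda>n. unary (slots S n)) \<and>
     (\<forall>f. polytime_computable (\<lambda>(n, evk, c, c'). slist [unary n, evk, c, c'])
            (\<lambda>(n, evk, c, c'). hom_cc S f n evk c c')) \<and>
     (\<forall>f. polytime_computable (\<lambda>(n, evk, c, v). slist [unary n, evk, c, v])
            (\<lambda>(n, evk, c, v). hom_cp S f n evk c (read_vec (prec S n) v))) \<and>
     polytime_computable (\<lambda>(n, evk, c, k). slist [unary n, evk, c, unary k])
       (\<lambda>(n, evk, c, k). hom_rot S n evk c k)"

text \<open>Probability that the attacker outputs 1 on an input drawn from \<open>D\<close>.\<close>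

definition pr_one :: "com \<Rightarrow> sexp pmf \<Rightarrow> real" where
  "pr_one A D = spmf (bind_spmf (spmf_of_pmf D) (result A)) (sbit True)"

definition cpa_input :: "fhe \<Rightarrow> nat \<Rightarrow> real list \<Rightarrow> sexp pmf" where
  "cpa_input S n m = do {
     (pk, evk, sk) \<leftarrow> keygen S n;
     c \<leftarrow> enc S n pk m;
     return_pmf (slist [unary n, pk, evk, c])
   }"

text \<open>
  A chooser outputs \<open>((m\<^sub>0, m\<^sub>1), state)\<close>.  Experiments with an inadmissible choice output 0.
\<close>

definition choice :: "nat \<Rightarrow> bool \<Rightarrow> sexp \<Rightarrow> real list" where
  "choice p b y = read_vec p (if b then cdr (car y) else car (car y))"

definition cpa_chosen :: "fhe \<Rightarrow> com \<Rightarrow> com \<Rightarrow> nat \<Rightarrow> bool \<Rightarrow> sexp spmf" where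
  "cpa_chosen S A1 A2 n b = do {
     (pk, evk, sk) \<leftarrow> spmf_of_pmf (keygen S n);
     y \<leftarrow> result A1 (slist [unary n, pk, evk]);
     if \<forall>b. length (choice (prec S n) b y) = slots S n
     then do {
       c \<leftarrow> spmf_of_pmf (enc S n pk (choice (prec S n) b y));
       result A2 (Cell (cdr y) (slist [unary n, pk, evk, c]))
     }
     else return_spmf (sbit False)
   }"

text \<open>
  Indistinguishability both for arbitrary messages fixed beforehand and for messages chosen
  by the adversary given the public keys.
\<close>

definition ind_cpa :: "fhe \<Rightarrow> bool" where
  "ind_cpa S \<longleftrightarrow>
     (\<forall>A m m'. ppt A \<longrightarrow> (\<forall>n. length (m n) = slots S n \<and> length (m' n) = slots S n) \<longrightarrow>
        negligible_fun (\<lambda>n. \<bar>pr_one A (cpa_input S n (m n)) - pr_one A (cpa_input S n (m' n))\<bar>)) \<and>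
     (\<forall>A1 A2. ppt A1 \<longrightarrow> ppt A2 \<longrightarrow>
        negligible_fun (\<lambda>n. \<bar>spmf (cpa_chosen S A1 A2 n False) (sbit True) -
                         spmf (cpa_chosen S A1 A2 n True) (sbit True)\<bar>))"


section \<open>The inference protocol\<close>

text \<open>
  Ciphertext operands of a gate are indices into the list of ciphertexts available so far
  (index 0 is the ciphertext received from the client); plaintext operands are indices into
  the list of plaintext vectors of the server.
\<close>

datatype gate =
    GateCC arith nat nat
  | GateCP arith nat nat
  | GateRot nat nat

primrec enc_arith :: "arith \<Rightarrow> sexp" where
  "enc_arith Add = unary 0"
| "enc_arith Sub = unary 1"
| "enc_arith Mul = unary 2"

primrec enc_gate :: "gate \<Rightarrow> sexp" where
  "enc_gate (GateCC f i j) = slist [unary 0, enc_arith f, unary i, unary j]"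
| "enc_gate (GateCP f i k) = slist [unary 1, enc_arith f, unary i, unary k]"
| "enc_gate (GateRot i k) = slist [unary 2, unary i, unary k]"

primrec wf_gate :: "nat \<Rightarrow> nat \<Rightarrow> gate \<Rightarrow> bool" where
  "wf_gate w l (GateCC f i j) \<longleftrightarrow> i < w \<and> j < w"
| "wf_gate w l (GateCP f i k) \<longleftrightarrow> i < w \<and> k < l"
| "wf_gate w l (GateRot i k) \<longleftrightarrow> i < w"

primrec eval_gate :: "fhe \<Rightarrow> nat \<Rightarrow> sexp \<Rightarrow> sexp list \<Rightarrow> sexp list \<Rightarrow> gate \<Rightarrow> sexp" where
  "eval_gate S n evk vs ws (GateCC f i j) = hom_cc S f n evk (ws ! i) (ws ! j)"
| "eval_gate S n evk vs ws (GateCP f i k) =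
     hom_cp S f n evk (ws ! i) (read_vec (prec S n) (vs ! k))"
| "eval_gate S n evk vs ws (GateRot i k) = hom_rot S n evk (ws ! i) k"

definition eval_circuit ::
  "fhe \<Rightarrow> nat \<Rightarrow> sexp \<Rightarrow> sexp list \<Rightarrow> gate list \<Rightarrow> sexp \<Rightarrow> sexp list" where
  "eval_circuit S n evk vs gs c = foldl (\<lambda>ws g. ws @ [eval_gate S n evk vs ws g]) [c] gs"

text \<open>
  \<open>idim\<close> is the input dimension \<open>d\<close>, \<open>model\<close> the plaintext vectors with the network weights and
  the fixed parameters, \<open>params\<close> the parameters sent to the client in the clear.  The server
  tosses \<open>ncoins\<close> coins, from which \<open>noise\<close> computes further plaintext vectors.
\<close>

record server =
  idim :: "nat \<Rightarrow> nat"
  model :: "nat \<Rightarrow> sexp list"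
  params :: "nat \<Rightarrow> sexp"
  ncoins :: "nat \<Rightarrow> nat"
  noise :: "nat \<Rightarrow> bool list \<Rightarrow> sexp list"
  circuit :: "nat \<Rightarrow> gate list"

definition server_descr :: "server \<Rightarrow> nat \<Rightarrow> sexp" where
  "server_descr P n = slist [unary (idim P n), slist (model P n), params P n,
     unary (ncoins P n), slist (map enc_gate (circuit P n))]"

text \<open>
  Uniformity: the description of the server (network, parameters, circuit) is computable in
  polynomial time from the security parameter; in particular the circuit has polynomial size.
\<close>

definition inference_server :: "fhe \<Rightarrow> server \<Rightarrow> bool" where
  "inference_server S P \<longleftrightarrow>
     polytime_computable unary (server_descr P) \<and>
     polytime_computable (\<lambda>(n, r). Cell (unary n) (bits r)) (\<lambda>(n, r). slist (noise P n r)) \<and>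
     (\<forall>n. idim P n \<le> slots S n) \<and>
     (\<forall>n r. length r = ncoins P n \<longrightarrow>
        (\<forall>v \<in> set (model P n @ noise P n r). length (unslist v) = slots S n) \<and>
        (\<forall>j < length (circuit P n).
           wf_gate (Suc j) (length (model P n @ noise P n r)) (circuit P n ! j)))"

definition random_bits :: "nat \<Rightarrow> bool list pmf" where
  "random_bits k = pmf_of_set {r. length r = k}"

definition pad :: "nat \<Rightarrow> real list \<Rightarrow> real list" where
  "pad M x = x @ replicate (M - length x) 0"

text \<open>
  Honest execution under given keys: the state of the server at the end, and the value
  decrypted by the client, which stays with the client.
\<close>

definition protocol ::
  "fhe \<Rightarrow> server \<Rightarrow> nat \<Rightarrow> sexp \<times> sexp \<times> sexp \<Rightarrow> real list \<Rightarrow> (sexp \<times> real list) pmf" where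
  "protocol S P n = (\<lambda>(pk, evk, sk) x. do {
     c \<leftarrow> enc S n pk (pad (slots S n) x);
     r \<leftarrow> random_bits (ncoins P n);
     let vs = noise P n r;
     let ws = eval_circuit S n evk (model P n @ vs) (circuit P n) c;
     let ret = last ws;
     let view = slist [unary n, pk, evk, c, server_descr P n, bits r, slist vs, slist ws, ret];
     return_pmf (view, dec S n sk ret)
   })"

definition view_under_keys ::
  "fhe \<Rightarrow> server \<Rightarrow> nat \<Rightarrow> sexp \<times> sexp \<times> sexp \<Rightarrow> real list \<Rightarrow> sexp pmf" where
  "view_under_keys S P n keys x = map_pmf fst (protocol S P n keys x)"

definition server_view :: "fhe \<Rightarrow> server \<Rightarrow> nat \<Rightarrow> real list \<Rightarrow> sexp pmf" where
  "server_view S P n x = bind_pmf (keygen S n) (\<lambda>keys. view_under_keys S P n keys x)"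

definition view_chosen :: "fhe \<Rightarrow> server \<Rightarrow> com \<Rightarrow> com \<Rightarrow> nat \<Rightarrow> bool \<Rightarrow> sexp spmf" where
  "view_chosen S P A1 A2 n b = do {
     (pk, evk, sk) \<leftarrow> spmf_of_pmf (keygen S n);
     y \<leftarrow> result A1 (slist [unary n, pk, evk]);
     if (\<forall>b. length (choice (prec S n) b y) = idim P n) \<and>
        choice (prec S n) False y \<noteq> choice (prec S n) True y
     then do {
       v \<leftarrow> spmf_of_pmf (view_under_keys S P n (pk, evk, sk) (choice (prec S n) b y));
       result A2 (Cell (cdr y) v)
     }
     else return_spmf (sbit False)
   }"

end

theory Submission
  imports Defs
begin

text \<open>
  The server's view is a randomised polynomial-time function of the public data
  \<open>(n, pk, evk, c)\<close>: noise and gates never touch the secret key.  A distinguisher of views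
  composed with this function is therefore an IND-CPA adversary with the same advantage.
  The composition has to be carried out as a WHILE program that is polynomial on all inputs,
  malformed ones included: the first component of the input is replaced by the unary numeral
  of its length, after which every homomorphic operation returns a ciphertext, so that sizes
  do not compound along the circuit.  For messages chosen by the attacker, the first stage of
  the reduction additionally checks lengths and pads.
\<close>

section \<open>Frame and clock properties of programs\<close>

text \<open>The hypotheses supply programs whose results are known on well-formed encodings only,
  while \<open>ppt\<close> demands a time bound on every S-expression. \<open>efficient E F\<close>
  mediates: it speaks about the inputs \<open>E i\<close> alone, and for the identity encoding it
  amounts to \<open>ppt\<close>. Composition rests on two facts. Any such program can be made to
  start and end with all registers but 0 empty while leaving one private register alone
  (\<open>realizes\<close>); and \<open>F i\<close> depends on \<open>i\<close> only through
  \<open>E i\<close>, so intermediate indices can be recovered from their codes. Iteration does not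
  preserve polynomial time by itself; hence the potential in the rule for folds, which for circuits
  is the security parameter stored in the state. Deciding whether two chosen inputs differ would
  mean comparing reals whose mantissas have several representations; the reduction avoids this,
  because equal choices cancel in the difference of the two experiments.\<close>

lemma loop_commute:
  assumes g: "\<And>s. g (h s) = g s" and f: "\<And>s. f (h s) = map_spmf h (f s)"
  shows "loop g f (h s) = map_spmf h (loop g f s)"
proof (induction arbitrary: s rule: loop.fixp_induct)
  case (3 L)
  then show ?case by (simp add: g f bind_map_spmf map_spmf_bind_spmf o_def)
qed simp_all

lemma loop_invariant:
  assumes "\<And>s s'. I s \<Longrightarrow> g s \<Longrightarrow> s' \<in> set_spmf (f s) \<Longrightarrow> I s'"
  shows "I s \<Longrightarrow> set_spmf (loop g f s) \<subseteq> Collect I"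
proof (induction arbitrary: s rule: loop.fixp_induct)
  case (3 L)
  then show ?case using assms by (auto simp: set_bind_spmf bind_UNION)
qed simp_all

primrec expr_bound :: "expr \<Rightarrow> nat" where
  "expr_bound (EVar x) = Suc x"
| "expr_bound ENull = 0"
| "expr_bound (ECell a b) = max (expr_bound a) (expr_bound b)"
| "expr_bound (ECar a) = expr_bound a"
| "expr_bound (ECdr a) = expr_bound a"

primrec com_bound :: "com \<Rightarrow> nat" where
  "com_bound (Assign x e) = max (Suc x) (expr_bound e)"
| "com_bound (Flip x) = Suc x"
| "com_bound (Seq c c') = max (com_bound c) (com_bound c')"
| "com_bound (Cond x c c') = max (Suc x) (max (com_bound c) (com_bound c'))"
| "com_bound (While x c) = max (Suc x) (com_bound c)"

lemma eval_expr_frame: "expr_bound e \<le> m \<Longrightarrow> eval_expr e (s(m := v)) = eval_expr e s"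
  by (induction e) auto

text \<open>Registers from \<open>com_bound c\<close> on cannot influence the run. The clock shift
  is proved together with the overwritten register because both form one state map, which has to
  commute with the guard and the body of a loop; fixed point induction then covers diverging runs as
  well.\<close>

lemma run_frame:
  assumes "com_bound c \<le> m"
  shows "run c (s(m := v), t + k) = map_spmf (\<lambda>(s, t). (s(m := v), t + k)) (run c (s, t))"
  using assms
proof (induction c arbitrary: s t)
  case (Assign x e)
  then have "x \<noteq> m" "expr_bound e \<le> m" by auto
  then show ?case by (simp add: eval_expr_frame fun_upd_twist del: fun_upd_apply)
next
  case (Flip x)
  then have "x \<noteq> m" by auto
  then show ?case by (simp add: spmf.map_comp o_def fun_upd_twist del: fun_upd_apply)
next
  case (Seq c c')
  then show ?case
    by (simp add: map_spmf_bind_spmf bind_map_spmf o_def case_prod_unfold)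
next
  case (Cond x c c')
  then show ?case by (simp flip: add_Suc)
next
  case (While x c)
  have "loop (\<lambda>(s, t). s x \<noteq> Null) (\<lambda>(s, t). run c (s, t + 1)) ((\<lambda>(s, t). (s(m := v), t + k)) (s, t)) =
    map_spmf (\<lambda>(s, t). (s(m := v), t + k))
      (loop (\<lambda>(s, t). s x \<noteq> Null) (\<lambda>(s, t). run c (s, t + 1)) (s, t))"
    by (rule loop_commute) (use While in \<open>auto simp flip: add_Suc\<close>)
  then show ?case by (simp del: fun_upd_apply)
qed

text \<open>Overwriting register \<open>m\<close> by its own initial value leaves the initial state
  as it is, so by the frame property every outcome lies in the image of that overwriting.\<close>

lemma run_untouched:
  assumes "com_bound c \<le> m" "(s', t') \<in> set_spmf (run c (s, t))"
  shows "s' m = s m"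
proof -
  have "run c (s, t) = map_spmf (\<lambda>(s', t). (s'(m := s m), t)) (run c (s, t))"
    using run_frame[OF assms(1), of s "s m" t 0] by simp
  then have "(s', t') \<in> (\<lambda>(s', t). (s'(m := s m), t)) ` set_spmf (run c (s, t))"
    using assms(2) by (metis set_map_spmf)
  then show ?thesis by auto
qed

text \<open>Assignments are charged the size of the stored value, so the excess over
  \<open>B\<close> never exceeds the clock. This turns time bounds into bounds on outputs.\<close>

lemma run_size:
  assumes "(s', t') \<in> set_spmf (run c (s, t))" "\<And>r. size (s r) \<le> B + t"
  shows "size (s' r) \<le> B + t'"
  using assms
proof (induction c arbitrary: s t s' t' r)
  case (Assign x e)
  then have "s' = s(x := eval_expr e s)" "t' = t + 1 + size (eval_expr e s)"
    by simp_all
  with Assign.prems(2)[of r] show ?case by (cases "r = x") simp_all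
next
  case (Flip x)
  have "size (sbit b) \<le> Suc (B + t)" for b by (simp add: sbit_def)
  with Flip show ?case by (auto simp: le_SucI)
next
  case (Seq c c')
  then show ?case by (fastforce simp: set_bind_spmf)
next
  case (Cond x c c')
  from Cond.prems(2) have "size (s r) \<le> B + (t + 1)" for r by (simp add: le_SucI)
  with Cond show ?case by (auto split: if_splits)
next
  case (While x c)
  have "set_spmf (loop (\<lambda>(s, t). s x \<noteq> Null) (\<lambda>(s, t). run c (s, t + 1)) (s, t)) \<subseteq>
    Collect (\<lambda>(s, t). \<forall>r. size (s r) \<le> B + t)"
    by (rule loop_invariant) (use While in \<open>auto intro: While.IH simp: le_SucI\<close>)
  with While show ?case by auto
qed

section \<open>Clean states and clean-up\<close>

definition init :: "sexp \<Rightarrow> nat \<Rightarrow> sexp" where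
  "init v = (\<lambda>_. Null)(0 := v)"

lemma init_0 [simp]: "init v 0 = v"
  by (simp add: init_def)

lemma init_pos [simp]: "r > 0 \<Longrightarrow> init v r = Null"
  by (simp add: init_def)

lemma init_upd_0 [simp]: "(init v)(0 := w) = init w"
  by (simp add: init_def)

lemma init_upd_Null [simp]: "r > 0 \<Longrightarrow> (init v)(r := Null) = init v"
  by (auto simp: init_def)

lemma init_upd_upd_0 [simp]: "r > 0 \<Longrightarrow> (init v)(r := u, 0 := w) = (init w)(r := u)"
  by (auto simp: init_def)

text \<open>Register 1 is erased even for \<open>k = 0\<close>, so registers 1 to
  \<open>k + 1\<close> are emptied. Each assignment costs one tick because
  \<open>size Null = 0\<close>.\<close>

primrec clear :: "nat \<Rightarrow> com" where
  "clear 0 = Assign 1 ENull"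
| "clear (Suc k) = Seq (clear k) (Assign (Suc (Suc k)) ENull)"

lemma run_clear:
  "run (clear k) (s, t) = return_spmf (\<lambda>r. if 0 < r \<and> r \<le> Suc k then Null else s r, t + Suc k)"
  by (induction k) (auto simp: fun_eq_iff)

lemma poly_mono_nat: "x \<le> y \<Longrightarrow> poly (p :: nat poly) x \<le> poly p y"
  by (induction p) (auto intro: add_mono mult_mono)

section \<open>Efficiently computable families of distributions\<close>

definition efficient :: "('i \<Rightarrow> sexp) \<Rightarrow> ('i \<Rightarrow> sexp spmf) \<Rightarrow> bool" where
  "efficient E F \<longleftrightarrow> (\<exists>c. \<exists>p :: nat poly. \<forall>i. lossless_spmf (exec c (E i)) \<and>
     (\<forall>(s, t) \<in> set_spmf (exec c (E i)). t \<le> poly p (size (E i))) \<and> result c (E i) = F i)"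

lemma exec_init: "exec c x = run c (init x, 0)"
  by (simp add: exec_def init_def)

lemma ppt_imp_efficient: "ppt c \<Longrightarrow> efficient (\<lambda>x. x) (result c)"
  unfolding efficient_def ppt_def by blast

lemma efficient_imp_ppt:
  assumes "efficient (\<lambda>x. x) F"
  obtains c where "ppt c" "result c = F"
  using assms unfolding efficient_def ppt_def by (metis ext)

lemma efficient_reindex: "efficient E F \<Longrightarrow> efficient (\<lambda>i. E (h i)) (\<lambda>i. F (h i))"
  unfolding efficient_def by meson

text \<open>A program sees an index only through its code. An index may therefore be replaced by any
  other with the same code, and encodings need not be injective.\<close>

lemma efficient_determined: "efficient E F \<Longrightarrow> E i = E j \<Longrightarrow> F i = F j"
  unfolding efficient_def by metis

text \<open>The interface of a callable subroutine. \<open>T i\<close> is the joint law of output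
  and elapsed time, independent of the initial clock and of the content \<open>v\<close> of register
  \<open>m\<close>. All other registers except 0 are empty before and after, so calls can be
  chained; \<open>m\<close> lets the caller keep a value across a call.\<close>

definition realizes ::
  "com \<Rightarrow> nat \<Rightarrow> nat poly \<Rightarrow> ('i \<Rightarrow> (sexp \<times> nat) spmf) \<Rightarrow> ('i \<Rightarrow> sexp) \<Rightarrow> ('i \<Rightarrow> sexp spmf) \<Rightarrow> bool" where
  "realizes c m p T E F \<longleftrightarrow> m > 0 \<and> (\<forall>i. lossless_spmf (T i) \<and> map_spmf fst (T i) = F i \<and>
     (\<forall>(y, t) \<in> set_spmf (T i). t \<le> poly p (size (E i)) \<and> size y \<le> poly p (size (E i))) \<and>
     (\<forall>v t. run c ((init (E i))(m := v), t) = map_spmf (\<lambda>(y, t'). ((init y)(m := v), t + t')) (T i)))"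

lemma realizesD:
  assumes "realizes c m p T E F"
  shows "m > 0" "lossless_spmf (T i)" "map_spmf fst (T i) = F i"
    "(y, t) \<in> set_spmf (T i) \<Longrightarrow> t \<le> poly p (size (E i))"
    "(y, t) \<in> set_spmf (T i) \<Longrightarrow> size y \<le> poly p (size (E i))"
    "run c ((init (E i))(m := v), t') = map_spmf (\<lambda>(y, t). ((init y)(m := v), t' + t)) (T i)"
    "run c (init (E i), t') = map_spmf (\<lambda>(y, t). (init y, t' + t)) (T i)"
proof -
  have *: "run c ((init (E i))(m := v), t') = map_spmf (\<lambda>(y, t). ((init y)(m := v), t' + t)) (T i)" for v
    using assms unfolding realizes_def by blast
  show "m > 0" "lossless_spmf (T i)" "map_spmf fst (T i) = F i"
    "(y, t) \<in> set_spmf (T i) \<Longrightarrow> t \<le> poly p (size (E i))"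
    "(y, t) \<in> set_spmf (T i) \<Longrightarrow> size y \<le> poly p (size (E i))"
    using assms unfolding realizes_def by blast+
  show "run c ((init (E i))(m := v), t') = map_spmf (\<lambda>(y, t). ((init y)(m := v), t' + t)) (T i)"
    by (rule *)
  show "run c (init (E i), t') = map_spmf (\<lambda>(y, t). (init y, t' + t)) (T i)"
    using *[of Null] \<open>m > 0\<close> by (simp del: fun_upd_apply)
qed

lemma efficient_realizer:
  assumes "efficient E F"
  obtains c m p T where "realizes c m p T E F"
proof -
  from assms obtain c0 p0 where c0: "\<And>i. lossless_spmf (exec c0 (E i))"
    "\<And>i s t. (s, t) \<in> set_spmf (exec c0 (E i)) \<Longrightarrow> t \<le> poly p0 (size (E i))"
    "\<And>i. result c0 (E i) = F i"
    unfolding efficient_def by fastforce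
  define b where "b = com_bound c0"
  \<comment> \<open>\<open>clear b\<close> empties registers up to \<open>b + 1\<close>, so
    \<open>b + 2\<close> is the first one that neither \<open>c0\<close> nor the clean-up touches.
    In \<open>p\<close>, \<open>Suc b\<close> pays for the clean-up and the linear term is the
    input's share in the size of the output.\<close>
  define m where "m = Suc (Suc b)"
  define p where "p = p0 + [:Suc b, 1:]"
  define T where "T = (\<lambda>i. map_spmf (\<lambda>(s, t). (s 0, t + Suc b)) (exec c0 (E i)))"
  have 1: "lossless_spmf (T i)" for i by (simp add: T_def c0)
  have 2: "map_spmf fst (T i) = F i" for i
    by (simp add: T_def spmf.map_comp o_def case_prod_unfold flip: c0(3))
       (simp add: result_def case_prod_unfold)
  have 3: "t \<le> poly p (size (E i)) \<and> size y \<le> poly p (size (E i))" if "(y, t) \<in> set_spmf (T i)" for i y t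
  proof -
    from that obtain s t0 where st: "(s, t0) \<in> set_spmf (exec c0 (E i))" "t = t0 + Suc b" "y = s 0"
      by (auto simp: T_def)
    have "size (init (E i) r) \<le> size (E i) + 0" for r by (cases "r = 0") simp_all
    from run_size[OF st(1)[unfolded exec_init] this, of 0] c0(2)[OF st(1)] st(2,3)
    show ?thesis by (simp add: p_def)
  qed
  have 4: "run (Seq c0 (clear b)) ((init (E i))(m := v), t) =
      map_spmf (\<lambda>(y, t'). ((init y)(m := v), t + t')) (T i)" for i v t
  proof -
    have "run c0 ((init (E i))(m := v), t) = map_spmf (\<lambda>(s, t'). (s(m := v), t' + t)) (exec c0 (E i))"
      using run_frame[of c0 m "init (E i)" v 0 t] by (simp add: m_def b_def exec_init)
    then have "run (Seq c0 (clear b)) ((init (E i))(m := v), t) =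
      map_spmf (\<lambda>(s, t'). (\<lambda>r. if 0 < r \<and> r \<le> Suc b then Null else (s(m := v)) r, t' + t + Suc b))
        (exec c0 (E i))"
      by (simp add: bind_map_spmf o_def map_spmf_conv_bind_spmf case_prod_unfold run_clear
          del: fun_upd_apply)
    also have "\<dots> = map_spmf (\<lambda>(s, t'). ((init (s 0))(m := v), t + (t' + Suc b))) (exec c0 (E i))"
    proof (intro map_spmf_cong refl, clarify)
      fix s t' assume st: "(s, t') \<in> set_spmf (exec c0 (E i))"
      have "s r = Null" if "r > Suc b" for r
        using run_untouched[OF _ st[unfolded exec_init], of r] that by (simp add: b_def)
      then show "(\<lambda>r. if 0 < r \<and> r \<le> Suc b then Null else (s(m := v)) r) = (init (s 0))(m := v)
          \<and> t' + t + Suc b = t + (t' + Suc b)"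
        by (auto simp: init_def m_def fun_eq_iff)
    qed
    finally show ?thesis by (simp add: T_def spmf.map_comp o_def case_prod_unfold)
  qed
  have "realizes (Seq c0 (clear b)) m p T E F"
    unfolding realizes_def using 1 2 3 4 by (auto simp: m_def)
  then show ?thesis by (rule that)
qed

lemma efficientI:
  assumes "\<And>i. run c (init (E i), 0) = map_spmf (\<lambda>(y, t). (init y, t)) (T i)"
    and "\<And>i. lossless_spmf (T i)" "\<And>i. map_spmf fst (T i) = F i"
    and "\<And>i y t. (y, t) \<in> set_spmf (T i) \<Longrightarrow> t \<le> poly p (size (E i))"
  shows "efficient E F"
  unfolding efficient_def
proof (intro exI[of _ c] exI[of _ p] allI conjI)
  fix i
  show "lossless_spmf (exec c (E i))" by (simp add: exec_init assms)
  show "\<forall>(s, t) \<in> set_spmf (exec c (E i)). t \<le> poly p (size (E i))"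
    using assms(4) by (fastforce simp: exec_init assms(1))
  show "result c (E i) = F i"
    by (simp add: result_def exec_init assms(1) spmf.map_comp o_def case_prod_unfold flip: assms(3))
qed

section \<open>Closure under sequencing, branching and coin tossing\<close>

lemma efficient_bind:
  assumes "efficient E F" and K: "\<And>i. F i = map_spmf E' (K i)" and G: "efficient E' G"
  shows "efficient E (\<lambda>i. bind_spmf (K i) G)"
proof -
  from assms(1) obtain c1 m1 p1 T1 where "realizes c1 m1 p1 T1 E F" by (rule efficient_realizer)
  note 1 = realizesD[OF this]
  from G obtain c2 m2 p2 T2 where "realizes c2 m2 p2 T2 E' G" by (rule efficient_realizer)
  note 2 = realizesD[OF this]
  \<comment> \<open>An output of the first program is the code of some index; \<open>inv\<close>
    chooses one, and the choice is immaterial because \<open>G\<close> factors through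
    \<open>E'\<close>.\<close>
  define J where "J = inv E'"
  have range: "E' (J y) = y" if "(y, t) \<in> set_spmf (T1 i)" for i y t
  proof -
    from that have "y \<in> set_spmf (map_spmf fst (T1 i))" by (force simp: image_iff)
    then have "y \<in> range E'" by (auto simp: 1(3) K)
    then show ?thesis by (simp add: J_def f_inv_into_f)
  qed
  define T where "T = (\<lambda>i. bind_spmf (T1 i) (\<lambda>(y, t). map_spmf (\<lambda>(y', t'). (y', t + t')) (T2 (J y))))"
  show ?thesis
  proof (rule efficientI[where c = "Seq c1 c2" and T = T and p = "p1 + pcompose p2 p1"])
    fix i
    have "run c2 (init y, t) = map_spmf (\<lambda>(y, t'). (init y, t + t')) (T2 (J y))"
      if "(y, t) \<in> set_spmf (T1 i)" for y t
      using 2(7)[of "J y" t] range[OF that] by simp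
    then show "run (Seq c1 c2) (init (E i), 0) = map_spmf (\<lambda>(y, t). (init y, t)) (T i)"
      by (auto simp: T_def 1(7) bind_map_spmf map_spmf_bind_spmf spmf.map_comp o_def case_prod_unfold
          intro!: bind_spmf_cong)
    show "lossless_spmf (T i)" by (auto simp: T_def 1 2)
    have "map_spmf fst (T i) = bind_spmf (T1 i) (\<lambda>(y, t). G (J y))"
      by (simp add: T_def map_spmf_bind_spmf spmf.map_comp o_def case_prod_unfold flip: 2(3))
    also have "\<dots> = bind_spmf (map_spmf fst (T1 i)) (\<lambda>y. G (J y))"
      by (simp add: bind_map_spmf o_def case_prod_unfold)
    also have "\<dots> = bind_spmf (K i) (\<lambda>j. G (J (E' j)))"
      by (simp add: 1(3) K bind_map_spmf o_def)
    also have "(\<lambda>j. G (J (E' j))) = G"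
      by (rule ext, rule efficient_determined[OF G]) (simp add: J_def f_inv_into_f)
    finally show "map_spmf fst (T i) = bind_spmf (K i) G" .
    fix y t assume "(y, t) \<in> set_spmf (T i)"
    then obtain y1 t1 t2 where y1: "(y1, t1) \<in> set_spmf (T1 i)" and t2: "(y, t2) \<in> set_spmf (T2 (J y1))"
      and t: "t = t1 + t2" by (auto simp: T_def set_bind_spmf)
    have "t2 \<le> poly p2 (size y1)" using 2(4)[OF t2] range[OF y1] by simp
    also have "\<dots> \<le> poly p2 (poly p1 (size (E i)))" using 1(5)[OF y1] by (simp add: poly_mono_nat)
    finally show "t \<le> poly (p1 + pcompose p2 p1) (size (E i))"
      using 1(4)[OF y1] t by (simp add: poly_pcompose)
  qed
qed

text \<open>A program has a single input register, so an earlier value survives only by being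
  stashed in register \<open>m\<close> and paired with the result afterwards. The rules for pairs
  and local bindings rest on this.\<close>

lemma efficient_keep_input:
  assumes "efficient E F"
  shows "efficient E (\<lambda>i. map_spmf (\<lambda>y. Cell y (E i)) (F i))"
proof -
  from assms obtain c m p T where "realizes c m p T E F" by (rule efficient_realizer)
  note 1 = realizesD[OF this]
  define T' where "T' = (\<lambda>i. map_spmf (\<lambda>(y, t).
    (Cell y (E i), (1 + size (E i)) + t + (1 + size (Cell y (E i))) + 1)) (T i))"
  let ?c = "Seq (Assign m (EVar 0)) (Seq c (Seq (Assign 0 (ECell (EVar 0) (EVar m))) (Assign m ENull)))"
  have upd: "(init y)(m := u, 0 := w, m := Null) = init w" for y u w
    using 1(1) by (auto simp: init_def)
  \<comment> \<open>The total time is \<open>t + size y + 2 * size (E i) + 4\<close>, and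
    \<open>p\<close> bounds both \<open>t\<close> and \<open>size y\<close>.\<close>
  show ?thesis
  proof (rule efficientI[where c = ?c and T = T' and p = "p + p + [:4, 2:]"])
    fix i
    show "run ?c (init (E i), 0) = map_spmf (\<lambda>(y, t). (init y, t)) (T' i)"
      by (simp add: 1(6) T'_def bind_map_spmf spmf.map_comp map_spmf_conv_bind_spmf o_def
          case_prod_unfold upd del: fun_upd_apply) (use 1(1) in \<open>simp add: ac_simps\<close>)
    show "lossless_spmf (T' i)" by (simp add: T'_def 1)
    show "map_spmf fst (T' i) = map_spmf (\<lambda>y. Cell y (E i)) (F i)"
      by (simp add: T'_def spmf.map_comp o_def case_prod_unfold flip: 1(3))
    fix y t assume "(y, t) \<in> set_spmf (T' i)"
    then obtain y0 t0 where "(y0, t0) \<in> set_spmf (T i)" "t = (1 + size (E i)) + t0 + (1 + size (Cell y0 (E i))) + 1"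
      by (auto simp: T'_def)
    with 1(4,5)[of y0 t0 i] show "t \<le> poly (p + p + [:4, 2:]) (size (E i))" by simp
  qed
qed

text \<open>An expression may duplicate register contents, but the number of copies is fixed by its
  syntax; hence growth by a constant factor, with one \<open>k\<close> for all states.\<close>

lemma size_eval_expr:
  "\<exists>k. \<forall>s B. (\<forall>r. size (s r) \<le> B) \<longrightarrow> size (eval_expr e s) \<le> k * (B + 1)"
proof (induction e)
  case (EVar x)
  show ?case by (rule exI[of _ 1]) (auto simp: le_SucI)
next
  case (ECell a b)
  then obtain k l where "\<And>s B. (\<And>r. size (s r) \<le> B) \<Longrightarrow> size (eval_expr a s) \<le> k * (B + 1)"
    "\<And>s B. (\<And>r. size (s r) \<le> B) \<Longrightarrow> size (eval_expr b s) \<le> l * (B + 1)" by blast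
  then have "size (eval_expr (ECell a b) s) \<le> (k + l + 1) * (B + 1)" if "\<And>r. size (s r) \<le> B" for s B
  proof -
    have "size (eval_expr a s) \<le> k * (B + 1)" "size (eval_expr b s) \<le> l * (B + 1)"
      by (simp_all only: \<open>\<And>s B. (\<And>r. size (s r) \<le> B) \<Longrightarrow> size (eval_expr a s) \<le> k * (B + 1)\<close>
          \<open>\<And>s B. (\<And>r. size (s r) \<le> B) \<Longrightarrow> size (eval_expr b s) \<le> l * (B + 1)\<close> that)
    then show ?thesis by (simp add: algebra_simps)
  qed
  then show ?case by blast
next
  case (ECar a)
  have "size (car x) \<le> size x" for x by (cases x) auto
  with ECar show ?case by simp (meson le_trans)
next
  case (ECdr a)
  have "size (cdr x) \<le> size x" for x by (cases x) auto
  with ECdr show ?case by simp (meson le_trans)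
qed simp

lemma efficient_eval_expr: "efficient E (\<lambda>i. return_spmf (eval_expr e (init (E i))))"
proof -
  obtain k where k: "\<And>s B. (\<And>r. size (s r) \<le> B) \<Longrightarrow> size (eval_expr e s) \<le> k * (B + 1)"
    using size_eval_expr by blast
  have *: "size (init x r) \<le> size x" for x r by (cases "r = 0") auto
  show ?thesis
    by (rule efficientI[where c = "Assign 0 e" and p = "[:k + 1, k:]" and
          T = "\<lambda>i. return_spmf (eval_expr e (init (E i)), 1 + size (eval_expr e (init (E i))))"])
      (use k[OF *] in \<open>auto simp: algebra_simps\<close>)
qed

lemma efficient_cond:
  assumes "efficient E F" "efficient E G"
  shows "efficient (\<lambda>(b, i). Cell b (E i)) (\<lambda>(b, i). if b \<noteq> Null then F i else G i)"
proof -
  from assms(1) obtain c1 m1 p1 T1 where "realizes c1 m1 p1 T1 E F" by (rule efficient_realizer)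
  note 1 = realizesD[OF this]
  from assms(2) obtain c2 m2 p2 T2 where "realizes c2 m2 p2 T2 E G" by (rule efficient_realizer)
  note 2 = realizesD[OF this]
  \<comment> \<open>The test value travels in front of the argument and is moved to register 1. The
    first branch has to erase it before \<open>c1\<close> runs; in the second it is already
    \<open>Null\<close>, hence one tick less.\<close>
  let ?c = "Seq (Assign 1 (ECar (EVar 0))) (Seq (Assign 0 (ECdr (EVar 0)))
    (Cond 1 (Seq (Assign 1 ENull) c1) c2))"
  define T where "T = (\<lambda>(b, i). if b \<noteq> Null then map_spmf (\<lambda>(y, t). (y, size b + size (E i) + 4 + t)) (T1 i)
    else map_spmf (\<lambda>(y, t). (y, size b + size (E i) + 3 + t)) (T2 i))"
  define p where "p = p1 + p2 + [:4, 1:]"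
  show ?thesis
  proof (rule efficientI[where c = ?c and T = T and p = p]; clarify)
    fix b i
    show "run ?c (init (Cell b (E i)), 0) = map_spmf (\<lambda>(y, t). (init y, t)) (T (b, i))"
      by (auto simp: T_def 1(7) 2(7) spmf.map_comp o_def case_prod_unfold numeral_eq_Suc)
    show "lossless_spmf (T (b, i))" by (simp add: T_def 1 2)
    show "map_spmf fst (T (b, i)) = (if b \<noteq> Null then F i else G i)"
      by (simp add: T_def spmf.map_comp o_def case_prod_unfold 1(3)[symmetric] 2(3)[symmetric])
    fix y t assume "(y, t) \<in> set_spmf (T (b, i))"
    then have "t \<le> poly p1 (size (E i)) + poly p2 (size (E i)) + (size b + size (E i) + 4)"
      by (auto simp: T_def split: if_splits dest!: 1(4) 2(4))
    also have "\<dots> \<le> poly p (size (Cell b (E i)))"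
      using poly_mono_nat[of "size (E i)" "size (Cell b (E i))" p1] poly_mono_nat[of "size (E i)" "size (Cell b (E i))" p2]
      by (simp add: p_def)
    finally show "t \<le> poly p (size (Cell b (E i)))" .
  qed
qed

lemma efficient_coin: "efficient E (\<lambda>_. map_spmf sbit coin_spmf)"
  by (rule efficientI[where c = "Flip 0" and T = "\<lambda>_. map_spmf (\<lambda>b. (sbit b, 1)) coin_spmf" and p = "[:1:]"])
    (auto simp: spmf.map_comp o_def)

text \<open>The continuation sees the sampled value and the original input: pairs of the two form
  the index set of the second program. \<open>K i\<close> yields an index rather than its code, so
  later steps can rely on well-formed data.\<close>

lemma efficient_let:
  assumes "efficient E F" "\<And>i. F i = map_spmf E' (K i)"
    and "efficient (\<lambda>z. Cell (E' (fst z)) (E (snd z))) (\<lambda>z. G (fst z) (snd z))"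
  shows "efficient E (\<lambda>i. bind_spmf (K i) (\<lambda>j. G j i))"
proof -
  have "efficient E (\<lambda>i. bind_spmf (map_spmf (\<lambda>j. (j, i)) (K i)) (\<lambda>z. G (fst z) (snd z)))"
    by (rule efficient_bind[OF efficient_keep_input[OF assms(1)] _ assms(3)])
      (simp add: assms(2) spmf.map_comp o_def)
  then show ?thesis by (simp add: bind_map_spmf o_def)
qed

section \<open>Iteration over a list\<close>

primrec fold_spmf :: "('a \<Rightarrow> 'b \<Rightarrow> 'b spmf) \<Rightarrow> 'a list \<Rightarrow> 'b \<Rightarrow> 'b spmf" where
  "fold_spmf K [] s = return_spmf s"
| "fold_spmf K (x # xs) s = bind_spmf (K x s) (fold_spmf K xs)"

lemma fold_spmf_return: "fold_spmf (\<lambda>x s. return_spmf (f x s)) xs s = return_spmf (fold f xs s)"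
  by (induction xs arbitrary: s) simp_all

lemma slist_simps [simp]: "slist [] = Null" "slist (x # xs) = Cell x (slist xs)"
  by (simp_all add: slist_def)

lemma slist_unslist [simp]: "slist (unslist x) = x"
  by (induction x rule: unslist.induct) simp_all

lemma unslist_slist [simp]: "unslist (slist xs) = xs"
  by (induction xs) simp_all

lemma length_unslist_le: "length (unslist x) \<le> size x"
  by (induction x rule: unslist.induct) simp_all

lemma run_While:
  "run (While x c) (s, t) =
    (if s x \<noteq> Null then bind_spmf (run c (s, t + 1)) (run (While x c)) else return_spmf (s, t))"
  unfolding run.simps by (subst loop.simps) simp

text \<open>
  The potential \<open>\<mu>\<close> bounds the growth of the accumulator per step.  It must be invariant along
  the loop, since the growth of an arbitrary polynomial-time step would compound exponentially.
\<close>

lemma efficient_fold: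
  fixes K :: "sexp \<Rightarrow> sexp \<Rightarrow> sexp spmf" and q :: "nat poly"
  assumes K: "efficient (\<lambda>z. Cell (fst z) (snd z)) (\<lambda>z. K (fst z) (snd z))"
    and step: "\<And>x s s'. s' \<in> set_spmf (K x s) \<Longrightarrow> size s' \<le> size s + size x + poly q (\<mu> s)"
    and inv: "\<And>x s s'. s' \<in> set_spmf (K x s) \<Longrightarrow> \<mu> s' = \<mu> s"
    and le: "\<And>s. \<mu> s \<le> size s"
  shows "efficient (\<lambda>z. Cell (fst z) (snd z)) (\<lambda>z. fold_spmf K (unslist (fst z)) (snd z))"
proof -
  from K obtain c m p T
    where "realizes c m p T (\<lambda>z. Cell (fst z) (snd z)) (\<lambda>z. K (fst z) (snd z))"
    by (rule efficient_realizer)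
  note 1 = realizesD[OF this]
  \<comment> \<open>The law of output and time of the loop. The 4 consists of the loop test, the
    base cost of two assignments, and the \<open>Cell\<close> that joins \<open>x\<close> and
    \<open>s\<close>.\<close>
  define T' where "T' = rec_list (\<lambda>s. return_spmf (s, 0::nat)) (\<lambda>x xs r s. bind_spmf (T (x, s))
    (\<lambda>(y, t). map_spmf (\<lambda>(y', t'). (y', 4 + size x + size s + size (slist xs) + t + t')) (r y)))"
  have T'_simps: "T' [] s = return_spmf (s, 0)"
    "T' (x # xs) s = bind_spmf (T (x, s))
      (\<lambda>(y, t). map_spmf (\<lambda>(y', t'). (y', 4 + size x + size s + size (slist xs) + t + t')) (T' xs y))"
    for x xs s by (simp_all add: T'_def)
  define body where "body = Seq (Assign 0 (ECell (ECar (EVar m)) (EVar 0)))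
    (Seq (Assign m (ECdr (EVar m))) c)"
  have upd: "(init s)(m := u, 0 := w, m := v) = (init w)(m := v)" for s u v w
    using 1(1) by (auto simp: init_def)
  have loop: "run (While m body) ((init s)(m := slist xs), t) =
      map_spmf (\<lambda>(y, t'). (init y, t + t')) (T' xs s)" for xs s t
  proof (induction xs arbitrary: s t)
    case Nil
    then show ?case using 1(1) by (simp add: run_While T'_simps fun_upd_same del: fun_upd_apply run.simps)
  next
    case (Cons x xs)
    have "run body ((init s)(m := slist (x # xs)), t + 1) =
      run c ((init (Cell x s))(m := slist xs), t + (4 + size x + size s + size (slist xs)))"
      using 1(1) by (simp add: body_def upd fun_upd_same del: fun_upd_apply) (simp add: ac_simps numeral_eq_Suc)
    also have "\<dots> = map_spmf (\<lambda>(y, t'). ((init y)(m := slist xs), t + (4 + size x + size s + size (slist xs)) + t'))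
        (T (x, s))"
      using 1(6)[of "(x, s)"] by (simp del: fun_upd_apply)
    finally have body: "run body ((init s)(m := slist (x # xs)), t + 1) = \<dots>" .
    have "run (While m body) ((init s)(m := slist (x # xs)), t) =
      bind_spmf (run body ((init s)(m := slist (x # xs)), t + 1)) (run (While m body))"
      by (simp add: run_While[of _ _ "(init s)(m := Cell x (slist xs))"] del: run.simps)
    also have "\<dots> = map_spmf (\<lambda>(y, t'). (init y, t + t')) (T' (x # xs) s)"
      unfolding body
      by (simp add: bind_map_spmf map_spmf_bind_spmf spmf.map_comp o_def case_prod_unfold Cons.IH T'_simps
          add.assoc del: fun_upd_apply run.simps)
    finally show ?case .
  qed
  have lossless: "lossless_spmf (T' xs s)" for xs s
    by (induction xs arbitrary: s) (auto simp: T'_simps 1)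
  have result: "map_spmf fst (T' xs s) = fold_spmf K xs s" for xs s
  proof (induction xs arbitrary: s)
    case (Cons x xs)
    then show ?case using 1(3)[of "(x, s)", symmetric]
      by (simp add: T'_simps map_spmf_bind_spmf bind_map_spmf spmf.map_comp o_def case_prod_unfold)
  qed (simp add: T'_simps)
  \<comment> \<open>\<open>B\<close> bounds the accumulator, the list still to be read and all
    growth still to come. A step moves the size of \<open>x\<close> from the list to the accumulator
    and uses up one summand \<open>poly q (\<mu> s)\<close>; as \<mu> is invariant, the same
    \<open>B\<close> serves for the rest.\<close>
  have time: "t \<le> length xs * (4 + 2 * B + poly p B)"
    if "(y, t) \<in> set_spmf (T' xs s)" "size s + size (slist xs) + length xs * poly q (\<mu> s) \<le> B"
    for y t xs s B
    using that
  proof (induction xs arbitrary: s t)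
    case (Cons x xs)
    from Cons.prems(1) obtain y1 t1 t2 where y1: "(y1, t1) \<in> set_spmf (T (x, s))"
      and t2: "(y, t2) \<in> set_spmf (T' xs y1)"
      and t: "t = 4 + size x + size s + size (slist xs) + t1 + t2"
      by (auto simp: T'_simps set_bind_spmf)
    have "y1 \<in> set_spmf (K x s)"
      using y1 by (force simp: image_iff simp flip: 1(3)[of "(x, s)", simplified])
    note step = step[OF this] inv[OF this]
    have "t1 \<le> poly p (size (Cell x s))" using 1(4)[OF y1] by simp
    also have "\<dots> \<le> poly p B" using Cons.prems(2) by (intro poly_mono_nat) simp
    finally have "t1 \<le> poly p B" .
    moreover have "t2 \<le> length xs * (4 + 2 * B + poly p B)"
      by (rule Cons.IH[OF t2]) (use step Cons.prems(2) in simp)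
    ultimately show ?case using t Cons.prems(2) by simp
  qed (simp add: T'_simps)
  let ?c = "Seq (Assign m (ECar (EVar 0))) (Seq (Assign 0 (ECdr (EVar 0))) (While m body))"
  \<comment> \<open>Both the number of steps and \<mu> are at most the input size n, so
    \<open>B\<close> is n + n * q(n); \<open>R\<close> is the resulting bound on the cost of one
    step.\<close>
  define B where "B = [:0, 1:] + [:0, 1:] * q"
  define R where "R = 4 + 2 * B + pcompose p B"
  have R: "poly R n = 4 + 2 * poly B n + poly p (poly B n)" for n
    by (simp add: R_def poly_pcompose)
  show ?thesis
  proof (rule efficientI[where c = ?c and p = "[:2, 1:] + [:0, 1:] * R"
        and T = "\<lambda>z. map_spmf (\<lambda>(y, t). (y, 2 + size (fst z) + size (snd z) + t)) (T' (unslist (fst z)) (snd z))"])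
    fix z :: "sexp \<times> sexp"
    obtain x s where z: "z = (x, s)" by force
    have upd: "(init v)(m := u, 0 := w) = (init w)(m := u)" for v u w
      using 1(1) by (rule init_upd_upd_0)
    show "run ?c (init (Cell (fst z) (snd z)), 0) = map_spmf (\<lambda>(y, t). (init y, t))
      (map_spmf (\<lambda>(y, t). (y, 2 + size (fst z) + size (snd z) + t)) (T' (unslist (fst z)) (snd z)))"
      using 1(1) loop[of s "unslist x" "2 + size x + size s"]
      by (simp add: z upd spmf.map_comp o_def case_prod_unfold del: fun_upd_apply run.simps(5))
        (simp add: fun_upd_other upd ac_simps del: fun_upd_apply run.simps(5))
    fix y t assume "(y, t) \<in> set_spmf (map_spmf (\<lambda>(y, t). (y, 2 + size (fst z) + size (snd z) + t))
      (T' (unslist (fst z)) (snd z)))"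
    then obtain t' where t': "(y, t') \<in> set_spmf (T' (unslist x) s)" "t = 2 + size x + size s + t'"
      by (auto simp: z)
    let ?n = "size (Cell x s)"
    have "length (unslist x) \<le> ?n" using length_unslist_le[of x] by simp
    moreover have "poly q (\<mu> s) \<le> poly q ?n" using le[of s] by (intro poly_mono_nat) simp
    ultimately have "length (unslist x) * poly q (\<mu> s) \<le> ?n * poly q ?n" by (rule mult_le_mono)
    then have "t' \<le> length (unslist x) * poly R ?n"
      unfolding R by (intro time[OF t'(1)]) (simp add: B_def)
    also have "\<dots> \<le> ?n * poly R ?n"
      by (rule mult_le_mono1) fact
    finally show "t \<le> poly ([:2, 1:] + [:0, 1:] * R) (size (Cell (fst z) (snd z)))"
      by (simp add: z t'(2))
  qed (simp_all add: lossless result spmf.map_comp o_def case_prod_unfold)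
qed

section \<open>Polynomial-time functions\<close>

definition computes :: "('i \<Rightarrow> sexp) \<Rightarrow> ('i \<Rightarrow> sexp) \<Rightarrow> bool" where
  "computes E f \<longleftrightarrow> efficient E (\<lambda>i. return_spmf (f i))"

lemma polytime_computable_imp_computes:
  assumes "polytime_computable inp f"
  shows "computes inp f"
proof -
  from assms obtain c where "ppt c" "\<And>a. result c (inp a) = return_spmf (f a)"
    unfolding polytime_computable_def by blast
  then show ?thesis
    using efficient_reindex[OF ppt_imp_efficient, of c inp] by (simp add: computes_def)
qed

lemma efficient_compose:
  assumes "computes E f" "efficient f G"
  shows "efficient E G"
proof -
  have "efficient E (\<lambda>i. bind_spmf (return_spmf i) G)"
    by (rule efficient_bind[OF assms(1)[unfolded computes_def] _ assms(2)]) simp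
  then show ?thesis by simp
qed

lemma computes_trans: "computes E f \<Longrightarrow> computes f g \<Longrightarrow> computes E g"
  unfolding computes_def[of _ g] by (rule efficient_compose)

lemma computes_compose: "computes inp f \<Longrightarrow> computes E (\<lambda>i. inp (h i)) \<Longrightarrow> computes E (\<lambda>i. f (h i))"
  unfolding computes_def[of inp] computes_def[of E "\<lambda>i. f (h i)"]
  by (rule efficient_compose[rotated], rule efficient_reindex)

lemma computes_eval_expr: "computes E (\<lambda>i. eval_expr e (init (E i)))"
  unfolding computes_def by (rule efficient_eval_expr)

lemma computes_input: "computes E E"
  using computes_eval_expr[of E "EVar 0"] by simp

lemma computes_Null: "computes E (\<lambda>i. Null)"
  using computes_eval_expr[of E ENull] by simp

lemma computes_car: "computes E f \<Longrightarrow> computes E (\<lambda>i. car (f i))"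
  using computes_trans[OF _ computes_eval_expr[of f "ECar (EVar 0)"], of E] by simp

lemma computes_cdr: "computes E f \<Longrightarrow> computes E (\<lambda>i. cdr (f i))"
  using computes_trans[OF _ computes_eval_expr[of f "ECdr (EVar 0)"], of E] by simp

text \<open>The input is kept beside the first result, so that the second function can still be
  computed from it; a final expression selects both results and drops the input.\<close>

lemma computes_Cell:
  assumes "computes E f" "computes E g"
  shows "computes E (\<lambda>i. Cell (f i) (g i))"
proof -
  have keep: "computes E (\<lambda>i. Cell (h i) (E i))" if "computes E h" for E h :: "'b \<Rightarrow> sexp"
    using efficient_keep_input[OF that[unfolded computes_def]] by (simp add: computes_def)
  let ?E = "\<lambda>i. Cell (f i) (E i)"
  have "computes ?E E" using computes_cdr[OF computes_input[of ?E]] by simp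
  from computes_trans[OF this assms(2)] have "computes ?E g" .
  from keep[OF this] have "computes ?E (\<lambda>i. Cell (g i) (?E i))" .
  moreover have "computes (\<lambda>i. Cell (g i) (?E i)) (\<lambda>i. Cell (f i) (g i))"
    using computes_eval_expr[of "\<lambda>i. Cell (g i) (?E i)" "ECell (ECar (ECdr (EVar 0))) (ECar (EVar 0))"] by simp
  ultimately show ?thesis
    by (rule computes_trans[OF computes_trans[OF keep[OF assms(1)]]])
qed

lemma efficient_if:
  assumes "computes E b" "efficient E F" "efficient E G"
  shows "efficient E (\<lambda>i. if b i \<noteq> Null then F i else G i)"
  using efficient_reindex[OF efficient_cond[OF assms(2,3)], of "\<lambda>i. (b i, i)"]
    efficient_compose[OF computes_Cell[OF assms(1) computes_input]] by simp

lemma computes_if: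
  assumes "computes E b" "computes E f" "computes E g"
  shows "computes E (\<lambda>i. if b i \<noteq> Null then f i else g i)"
  using efficient_if[OF assms(1), of "\<lambda>i. return_spmf (f i)" "\<lambda>i. return_spmf (g i)"] assms(2,3)
  by (simp add: computes_def if_distrib[of return_spmf] cong: if_cong)

lemma computes_fold:
  assumes "computes (\<lambda>z. Cell (fst z) (snd z)) (\<lambda>z. f (fst z) (snd z))"
    and "\<And>x s. size (f x s) \<le> size s + size x + poly q (\<mu> s)"
    and "\<And>x s. \<mu> (f x s) = \<mu> s" "\<And>s. \<mu> s \<le> size s"
    and "computes E xs" "computes E s"
  shows "computes E (\<lambda>i. fold f (unslist (xs i)) (s i))"
proof -
  have "computes (\<lambda>z. Cell (fst z) (snd z)) (\<lambda>z. fold f (unslist (fst z)) (snd z))"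
    using efficient_fold[of "\<lambda>x s. return_spmf (f x s)" q \<mu>] assms(1-4)
    by (simp add: computes_def fold_spmf_return)
  from computes_compose[OF this, of E "\<lambda>i. (xs i, s i)"] computes_Cell[OF assms(5,6)]
  show ?thesis by simp
qed

lemma computes_CellD:
  assumes "computes E (\<lambda>i. Cell (f i) (g i))"
  shows "computes E f" "computes E g"
  using computes_car[OF assms] computes_cdr[OF assms] by simp_all

lemma computes_fst_snd:
  "computes (\<lambda>z. Cell (fst z) (snd z)) fst" "computes (\<lambda>z. Cell (fst z) (snd z)) snd"
  using computes_CellD[OF computes_input[of "\<lambda>z. Cell (fst z) (snd z)"]] by simp_all

lemma computes_weaken: "computes E f \<Longrightarrow> computes (\<lambda>z. Cell (E' (fst z)) (E (snd z))) (\<lambda>z. f (snd z))"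
  by (erule computes_compose[of E f], rule computes_CellD(2)[OF computes_input])

section \<open>Lists\<close>

lemma length_unslist_unary [simp]: "length (unslist (unary n)) = n"
  by (simp add: unary_def)

lemma size_car_cdr: "size (car x) + size (cdr x) \<le> size x"
  by (cases x) simp_all

lemma size_slist_snoc: "size (slist (xs @ [x])) = size (slist xs) + size x + 1"
  by (induction xs) simp_all

text \<open>Consing one \<open>Null\<close> per entry turns any S-expression into a unary numeral.
  This is how a security parameter or a rotation amount is read from possibly malformed
  data.\<close>

lemma computes_length:
  assumes "computes E f"
  shows "computes E (\<lambda>i. unary (length (unslist (f i))))"
proof -
  have "fold (\<lambda>_. Cell Null) xs (unary k) = unary (length xs + k)" for k and xs :: "sexp list"
    by (induction xs arbitrary: k) (simp_all add: unary_def flip: slist_simps(2) replicate_Suc)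
  from this[of _ 0] have eq: "fold (\<lambda>_. Cell Null) xs Null = unary (length xs)" for xs :: "sexp list"
    by (simp add: unary_def)
  have "computes E (\<lambda>i. fold (\<lambda>_. Cell Null) (unslist (f i)) Null)"
    by (rule computes_fold[where q = "[:1:]" and \<mu> = "\<lambda>_. 0"])
      (auto intro: computes_Cell computes_Null computes_fst_snd assms)
  then show ?thesis by (simp add: eq)
qed

lemma computes_drop:
  assumes "computes E k" "computes E f"
  shows "computes E (\<lambda>i. slist (drop (length (unslist (k i))) (unslist (f i))))"
proof -
  have "cdr (slist xs) = slist (tl xs)" for xs by (cases xs) simp_all
  then have "fold (\<lambda>_. cdr) ks (slist xs) = slist (drop (length ks) xs)" for xs and ks :: "sexp list"
    by (induction ks arbitrary: xs) (simp_all add: drop_Suc)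
  from this[of _ "unslist x" for x]
  have eq: "fold (\<lambda>_. cdr) ks x = slist (drop (length ks) (unslist x))" for x and ks :: "sexp list"
    by simp
  have "size (cdr x) \<le> size x" for x by (cases x) auto
  then have "computes E (\<lambda>i. fold (\<lambda>_. cdr) (unslist (k i)) (f i))"
    by (intro computes_fold[where q = 0 and \<mu> = "\<lambda>_. 0"])
      (auto intro: computes_cdr computes_fst_snd assms le_trans[OF _ le_add1])
  then show ?thesis by (simp add: eq)
qed

lemma computes_rev_append:
  assumes "computes E f" "computes E g"
  shows "computes E (\<lambda>i. slist (rev (unslist (f i)) @ unslist (g i)))"
proof -
  have "fold Cell xs (slist ys) = slist (rev xs @ ys)" for xs ys
    by (induction xs arbitrary: ys) (simp_all flip: slist_simps(2))
  from this[of _ "unslist y" for y]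
  have eq: "fold Cell xs y = slist (rev xs @ unslist y)" for xs y by simp
  have "computes E (\<lambda>i. fold Cell (unslist (f i)) (g i))"
    by (rule computes_fold[where q = "[:1:]" and \<mu> = "\<lambda>_. 0"])
      (auto intro: computes_Cell computes_fst_snd assms)
  then show ?thesis by (simp add: eq)
qed

lemma computes_rev: "computes E f \<Longrightarrow> computes E (\<lambda>i. slist (rev (unslist (f i))))"
  using computes_rev_append[OF _ computes_Null, of E f] by simp

lemma computes_append:
  "computes E f \<Longrightarrow> computes E g \<Longrightarrow> computes E (\<lambda>i. slist (unslist (f i) @ unslist (g i)))"
  using computes_rev_append[OF computes_rev, of E f g] by simp

text \<open>
  Unlike \<open>!\<close>, whose value is unspecified for indices out of range, this is computable as a total
  function.
\<close>

definition entry :: "sexp \<Rightarrow> sexp \<Rightarrow> sexp" where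
  "entry k x = car (slist (drop (length (unslist k)) (unslist x)))"

lemma entry_unary: "i < length xs \<Longrightarrow> entry (unary i) (slist xs) = xs ! i"
  by (simp add: entry_def flip: Cons_nth_drop_Suc)

lemma computes_entry: "computes E k \<Longrightarrow> computes E f \<Longrightarrow> computes E (\<lambda>i. entry (k i) (f i))"
  unfolding entry_def by (intro computes_car computes_drop)

section \<open>Random bits\<close>

lemma pair_pmf_of_set:
  assumes "finite A" "A \<noteq> {}" "finite B" "B \<noteq> {}"
  shows "pair_pmf (pmf_of_set A) (pmf_of_set B) = pmf_of_set (A \<times> B)"
proof (rule pmf_eqI)
  fix z :: "'a \<times> 'b"
  show "pmf (pair_pmf (pmf_of_set A) (pmf_of_set B)) z = pmf (pmf_of_set (A \<times> B)) z"
    using assms by (cases z) (simp add: pmf_pair indicator_def card_cartesian_product)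
qed

text \<open>The last bit is split off because the machine conses: the coin tossed first ends up at
  the end of the list.\<close>

lemma random_bits_Suc:
  "random_bits (Suc k) = bind_pmf (pmf_of_set UNIV) (\<lambda>b. map_pmf (\<lambda>r. r @ [b]) (random_bits k))"
proof -
  let ?L = "\<lambda>k. {r :: bool list. length r = k}"
  have fin: "finite (?L k)" for k
    using finite_lists_length_eq[of "UNIV :: bool set" k] by simp
  have ne: "?L k \<noteq> {}" for k using Ex_list_of_length by auto
  have img: "?L (Suc k) = (\<lambda>(b, r). r @ [b]) ` (UNIV \<times> ?L k)"
    by (auto simp: image_iff length_Suc_conv_rev)
  have "random_bits (Suc k) = map_pmf (\<lambda>(b, r). r @ [b]) (pmf_of_set (UNIV \<times> ?L k))"
    unfolding random_bits_def img
    by (rule map_pmf_of_set_inj[symmetric]) (use fin ne in \<open>auto simp: inj_on_def\<close>)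
  also have "pmf_of_set ((UNIV :: bool set) \<times> ?L k) = pair_pmf (pmf_of_set UNIV) (random_bits k)"
    unfolding random_bits_def by (rule pair_pmf_of_set[symmetric]) (use fin ne in simp_all)
  finally show ?thesis
    by (simp add: pair_pmf_def map_bind_pmf map_pmf_def bind_assoc_pmf bind_return_pmf)
qed

lemma spmf_random_bits_Suc:
  "spmf_of_pmf (random_bits (Suc k)) =
     bind_spmf coin_spmf (\<lambda>b. map_spmf (\<lambda>r. r @ [b]) (spmf_of_pmf (random_bits k)))"
proof -
  have "coin_spmf = spmf_of_pmf (pmf_of_set UNIV)" by (simp add: spmf_of_pmf_pmf_of_set)
  then show ?thesis
    by (simp only: random_bits_Suc bind_spmf_of_pmf spmf_of_pmf_bind map_spmf_of_pmf)
qed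

lemma set_random_bits: "set_pmf (random_bits k) = {r. length r = k}"
proof -
  have "finite {r :: bool list. length r = k}"
    using finite_lists_length_eq[of "UNIV :: bool set" k] by simp
  then show ?thesis unfolding random_bits_def
    by (intro set_pmf_of_set) (use Ex_list_of_length in auto)
qed

lemma efficient_random_bits:
  assumes "computes E (\<lambda>i. unary (k i))"
  shows "efficient E (\<lambda>i. map_spmf bits (spmf_of_pmf (random_bits (k i))))"
proof -
  let ?K = "\<lambda>x s. bind_spmf coin_spmf (\<lambda>b. return_spmf (Cell (sbit b) s))"
  have fold: "fold_spmf ?K xs (bits acc) =
      map_spmf (\<lambda>r. bits (r @ acc)) (spmf_of_pmf (random_bits (length xs)))" for xs :: "sexp list" and acc
  proof (induction xs arbitrary: acc)
    case Nil
    have "random_bits 0 = return_pmf []" by (simp add: random_bits_def pmf_of_set_singleton)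
    then show ?case by simp
  next
    case (Cons x xs)
    have "Cell (sbit b) (bits acc) = bits (b # acc)" for b by (simp add: bits_def)
    then have "fold_spmf ?K (x # xs) (bits acc) = bind_spmf coin_spmf (\<lambda>b.
      map_spmf (\<lambda>r. bits (r @ b # acc)) (spmf_of_pmf (random_bits (length xs))))"
      by (simp add: Cons.IH)
    also have "\<dots> = map_spmf (\<lambda>r. bits (r @ acc)) (spmf_of_pmf (random_bits (Suc (length xs))))"
      by (simp add: spmf_random_bits_Suc map_spmf_bind_spmf o_def pmf.map_comp)
    finally show ?case by simp
  qed
  \<comment> \<open>A step adds one \<open>Cell\<close> and a bit of size at most 1, so the growth
    is at most 2 whatever the accumulator.\<close>
  have "efficient (\<lambda>z. Cell (fst z) (snd z)) (\<lambda>z. fold_spmf ?K (unslist (fst z)) (snd z))"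
  proof (rule efficient_fold[where q = "[:2:]" and \<mu> = "\<lambda>_. 0"])
    show "efficient (\<lambda>z. Cell (fst z) (snd z)) (\<lambda>z. ?K (fst z) (snd z))"
    proof (rule efficient_let[OF efficient_coin refl], fold computes_def)
      let ?E = "\<lambda>z. Cell (sbit (fst z)) (Cell (fst (snd z)) (snd (snd z)))"
      show "computes ?E (\<lambda>z. Cell (sbit (fst z)) (snd (snd z)))"
        using computes_eval_expr[of ?E "ECell (ECar (EVar 0)) (ECdr (ECdr (EVar 0)))"] by simp
    qed
  qed (auto simp: sbit_def set_bind_spmf split: if_splits)
  from efficient_reindex[OF this, of "\<lambda>i. (unary (k i), Null)"]
  have "efficient (\<lambda>i. Cell (unary (k i)) Null) (\<lambda>i. fold_spmf ?K (unslist (unary (k i))) Null)"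
    by simp
  with computes_Cell[OF assms computes_Null]
  have "efficient E (\<lambda>i. fold_spmf ?K (unslist (unary (k i))) Null)" by (rule efficient_compose)
  moreover have "bits [] = Null" by (simp add: bits_def)
  ultimately show ?thesis using fold[of _ "[]"] by simp
qed

section \<open>Evaluation of the server's view\<close>

definition read_arith :: "sexp \<Rightarrow> arith" where
  "read_arith x = (if x \<noteq> Null then if cdr x \<noteq> Null then Mul else Sub else Add)"

lemma read_arith_enc [simp]: "read_arith (enc_arith f) = f"
  by (cases f) (simp_all add: read_arith_def unary_def numeral_eq_Suc)

text \<open>The scheme supplies one program per operation, whereas the operation of a gate is data
  read at run time. As there are only three, the choice becomes a nested conditional.\<close>

lemma computes_read_arith:
  assumes "computes E b" "\<And>f. computes E (G f)"
  shows "computes E (\<lambda>i. G (read_arith (b i)) i)"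
proof -
  have "computes E (\<lambda>i. if b i \<noteq> Null then if cdr (b i) \<noteq> Null then G Mul i else G Sub i else G Add i)"
    by (intro computes_if computes_cdr assms)
  also have "(\<lambda>i. if b i \<noteq> Null then if cdr (b i) \<noteq> Null then G Mul i else G Sub i else G Add i) =
    (\<lambda>i. G (read_arith (b i)) i)"
    by (auto simp: read_arith_def)
  finally show ?thesis .
qed

text \<open>A total interpreter of gate codes: the tags 0, 1, 2 are told apart by emptiness tests,
  and every S-expression falls into one of the three cases. Each branch ends in a homomorphic
  operation, so even a malformed gate yields a ciphertext.\<close>

definition read_gate :: "fhe \<Rightarrow> sexp \<Rightarrow> nat \<Rightarrow> sexp \<Rightarrow> sexp \<Rightarrow> sexp \<Rightarrow> sexp" where
  "read_gate S g n evk vs ws =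
     (if car g \<noteq> Null then
        if cdr (car g) \<noteq> Null then
          hom_rot S n evk (entry (car (cdr g)) ws) (length (unslist (car (cdr (cdr g)))))
        else hom_cp S (read_arith (car (cdr g))) n evk (entry (car (cdr (cdr g))) ws)
               (read_vec (prec S n) (entry (car (cdr (cdr (cdr g)))) vs))
      else hom_cc S (read_arith (car (cdr g))) n evk (entry (car (cdr (cdr g))) ws)
             (entry (car (cdr (cdr (cdr g)))) ws))"

lemma read_gate_enc:
  "wf_gate (length ws) (length vs) g \<Longrightarrow>
     read_gate S (enc_gate g) n evk (slist vs) (slist ws) = eval_gate S n evk vs ws g"
  by (cases g) (simp_all add: read_gate_def entry_unary, simp_all add: unary_def numeral_eq_Suc)

text \<open>The state of the circuit evaluation is (security parameter, evaluation keys, plaintexts, ciphertexts).\<close>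

definition gate_step :: "fhe \<Rightarrow> sexp \<Rightarrow> sexp \<Rightarrow> sexp" where
  "gate_step S g st =
     Cell (car st) (Cell (car (cdr st)) (Cell (car (cdr (cdr st)))
       (slist (unslist (cdr (cdr (cdr st))) @ unslist (Cell
         (read_gate S g (length (unslist (car st))) (car (cdr st)) (car (cdr (cdr st))) (cdr (cdr (cdr st))))
         Null)))))"

definition circuit_state :: "nat \<Rightarrow> sexp \<Rightarrow> sexp list \<Rightarrow> sexp list \<Rightarrow> sexp" where
  "circuit_state n evk vs ws = Cell (unary n) (Cell evk (Cell (slist vs) (slist ws)))"

lemma length_eval_circuit: "length (eval_circuit S n evk vs gs c) = Suc (length gs)"
  by (induction gs rule: rev_induct) (simp_all add: eval_circuit_def)

lemma eval_circuit_snoc: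
  "eval_circuit S n evk vs (gs @ [g]) c =
     (let ws = eval_circuit S n evk vs gs c in ws @ [eval_gate S n evk vs ws g])"
  by (simp add: eval_circuit_def Let_def)

lemma gate_step_enc:
  "wf_gate (length ws) (length vs) g \<Longrightarrow> gate_step S (enc_gate g) (circuit_state n evk vs ws) =
     circuit_state n evk vs (ws @ [eval_gate S n evk vs ws g])"
  by (simp add: gate_step_def circuit_state_def read_gate_enc)

text \<open>When gate \<open>j\<close> is reached, \<open>j + 1\<close> ciphertexts are present, the
  received one included; this matches the bound \<open>Suc j\<close>, so the total interpreter
  agrees with \<open>eval_gate\<close>. The last gate is peeled off because results are
  appended.\<close>

lemma fold_gate_step:
  assumes "\<forall>j < length gs. wf_gate (Suc j) (length vs) (gs ! j)"
  shows "fold (gate_step S) (map enc_gate gs) (circuit_state n evk vs [c]) =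
    circuit_state n evk vs (eval_circuit S n evk vs gs c)"
  using assms
proof (induction gs rule: rev_induct)
  case Nil
  show ?case by (simp add: eval_circuit_def)
next
  case (snoc g gs)
  have "wf_gate (Suc (length gs)) (length vs) g"
    using snoc.prems[rule_format, of "length gs"] by simp
  moreover have "fold (gate_step S) (map enc_gate gs) (circuit_state n evk vs [c]) =
      circuit_state n evk vs (eval_circuit S n evk vs gs c)"
  proof (rule snoc.IH, intro allI impI)
    fix j assume "j < length gs"
    then show "wf_gate (Suc j) (length vs) (gs ! j)"
      using snoc.prems[rule_format, of j] by (simp add: nth_append)
  qed
  ultimately show ?case
    by (simp add: gate_step_enc length_eval_circuit eval_circuit_snoc Let_def)
qed

definition view :: "fhe \<Rightarrow> server \<Rightarrow> nat \<Rightarrow> sexp \<Rightarrow> sexp \<Rightarrow> sexp \<Rightarrow> bool list \<Rightarrow> sexp" where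
  "view S P n pk evk c r =
     (let vs = noise P n r;
          ws = eval_circuit S n evk (model P n @ vs) (circuit P n) c
      in slist [unary n, pk, evk, c, server_descr P n, bits r, slist vs, slist ws, last ws])"

text \<open>The secret key enters only the decrypted value, which \<open>fst\<close>
  discards.\<close>

lemma view_under_keys_eq:
  "view_under_keys S P n (pk, evk, sk) x =
     bind_pmf (enc S n pk (pad (slots S n) x)) (\<lambda>c. map_pmf (view S P n pk evk c) (random_bits (ncoins P n)))"
  by (simp add: view_under_keys_def protocol_def map_bind_pmf view_def Let_def map_pmf_def bind_assoc_pmf bind_return_pmf)

section \<open>Efficiency of the view for a fixed scheme and server\<close>

locale inference =
  fixes S :: fhe and P :: server
  assumes scheme: "fhe_scheme S" and server: "inference_server S P"
begin

lemma computes_hom_cc: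
  assumes "computes E b" "computes E (\<lambda>i. unary (n i))" "computes E evk" "computes E c" "computes E c'"
  shows "computes E (\<lambda>i. hom_cc S (read_arith (b i)) (n i) (evk i) (c i) (c' i))"
proof (rule computes_read_arith[where G = "\<lambda>f i. hom_cc S f (n i) (evk i) (c i) (c' i)", OF assms(1)])
  fix f
  have "polytime_computable (\<lambda>(n, evk, c, c'). slist [unary n, evk, c, c'])
      (\<lambda>(n, evk, c, c'). hom_cc S f n evk c c')"
    using scheme by (simp add: fhe_scheme_def)
  from computes_compose[OF polytime_computable_imp_computes[OF this], of E "\<lambda>i. (n i, evk i, c i, c' i)"]
  show "computes E (\<lambda>i. hom_cc S f (n i) (evk i) (c i) (c' i))"
    using assms by (simp add: computes_Cell computes_Null)
qed

lemma computes_hom_cp: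
  assumes "computes E b" "computes E (\<lambda>i. unary (n i))" "computes E evk" "computes E c" "computes E v"
  shows "computes E (\<lambda>i. hom_cp S (read_arith (b i)) (n i) (evk i) (c i) (read_vec (prec S (n i)) (v i)))"
proof (rule computes_read_arith[where G = "\<lambda>f i. hom_cp S f (n i) (evk i) (c i) (read_vec (prec S (n i)) (v i))", OF assms(1)])
  fix f
  have "polytime_computable (\<lambda>(n, evk, c, v). slist [unary n, evk, c, v])
      (\<lambda>(n, evk, c, v). hom_cp S f n evk c (read_vec (prec S n) v))"
    using scheme by (simp add: fhe_scheme_def)
  from computes_compose[OF polytime_computable_imp_computes[OF this], of E "\<lambda>i. (n i, evk i, c i, v i)"]
  show "computes E (\<lambda>i. hom_cp S f (n i) (evk i) (c i) (read_vec (prec S (n i)) (v i)))"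
    using assms by (simp add: computes_Cell computes_Null)
qed

lemma computes_hom_rot:
  assumes "computes E (\<lambda>i. unary (n i))" "computes E evk" "computes E c" "computes E (\<lambda>i. unary (k i))"
  shows "computes E (\<lambda>i. hom_rot S (n i) (evk i) (c i) (k i))"
proof -
  have "polytime_computable (\<lambda>(n, evk, c, k). slist [unary n, evk, c, unary k])
      (\<lambda>(n, evk, c, k). hom_rot S n evk c k)"
    using scheme by (simp add: fhe_scheme_def)
  from computes_compose[OF polytime_computable_imp_computes[OF this], of E "\<lambda>i. (n i, evk i, c i, k i)"]
  show ?thesis using assms by (simp add: computes_Cell computes_Null)
qed

lemma computes_slots:
  assumes "computes E (\<lambda>i. unary (n i))"
  shows "computes E (\<lambda>i. unary (slots S (n i)))"
proof -
  have "polytime_computable unary (\<lambda>n. unary (slots S n))"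
    using scheme by (simp add: fhe_scheme_def)
  from computes_compose[OF polytime_computable_imp_computes[OF this] assms] show ?thesis .
qed

lemma computes_server_descr:
  assumes "computes E (\<lambda>i. unary (n i))"
  shows "computes E (\<lambda>i. server_descr P (n i))"
proof -
  have "polytime_computable unary (server_descr P)"
    using server by (simp add: inference_server_def)
  from computes_compose[OF polytime_computable_imp_computes[OF this] assms] show ?thesis .
qed

lemma computes_descr:
  assumes "computes E (\<lambda>i. unary (n i))"
  shows "computes E (\<lambda>i. unary (idim P (n i)))" "computes E (\<lambda>i. slist (model P (n i)))"
    "computes E (\<lambda>i. unary (ncoins P (n i)))" "computes E (\<lambda>i. slist (map enc_gate (circuit P (n i))))"
proof -
  note D = computes_server_descr[OF assms]
  show "computes E (\<lambda>i. unary (idim P (n i)))"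
    using computes_car[OF D] by (simp add: server_descr_def)
  show "computes E (\<lambda>i. slist (model P (n i)))"
    using computes_car[OF computes_cdr[OF D]] by (simp add: server_descr_def)
  show "computes E (\<lambda>i. unary (ncoins P (n i)))"
    using computes_car[OF computes_cdr[OF computes_cdr[OF computes_cdr[OF D]]]] by (simp add: server_descr_def)
  show "computes E (\<lambda>i. slist (map enc_gate (circuit P (n i))))"
    using computes_car[OF computes_cdr[OF computes_cdr[OF computes_cdr[OF computes_cdr[OF D]]]]]
    by (simp add: server_descr_def)
qed

lemma computes_noise:
  assumes "computes E (\<lambda>i. unary (n i))" "computes E (\<lambda>i. bits (r i))"
  shows "computes E (\<lambda>i. slist (noise P (n i) (r i)))"
proof -
  have "polytime_computable (\<lambda>(n, r). Cell (unary n) (bits r)) (\<lambda>(n, r). slist (noise P n r))"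
    using server by (simp add: inference_server_def)
  from computes_compose[OF polytime_computable_imp_computes[OF this], of E "\<lambda>i. (n i, r i)"]
  show ?thesis using computes_Cell[OF assms] by simp
qed

lemma computes_gate_step:
  assumes "computes E g" "computes E st"
  shows "computes E (\<lambda>i. gate_step S (g i) (st i))"
  unfolding gate_step_def read_gate_def
  by (intro computes_Cell computes_append computes_if computes_car computes_cdr computes_Null assms
      computes_hom_rot computes_entry computes_length computes_hom_cc computes_hom_cp)

lemma size_read_gate: "\<exists>q :: nat poly. \<forall>g n evk vs ws. size (read_gate S g n evk vs ws) \<le> poly q n"
proof -
  have "\<exists>q :: nat poly. \<forall>n. \<forall>c \<in> ctxts S n. size c \<le> poly q n"
    using scheme[unfolded fhe_scheme_def, THEN conjunct1] by blast
  moreover have "read_gate S g n evk vs ws \<in> ctxts S n" for g n evk vs ws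
    using scheme by (simp add: read_gate_def fhe_scheme_def)
  ultimately show ?thesis by blast
qed

lemma computes_fold_gate_step:
  assumes "computes E gs" "computes E st"
  shows "computes E (\<lambda>i. fold (gate_step S) (unslist (gs i)) (st i))"
proof -
  obtain q where q: "\<And>g n evk vs ws. size (read_gate S g n evk vs ws) \<le> poly q n"
    using size_read_gate by blast
  show ?thesis
  proof (rule computes_fold[OF _ _ _ _ assms])
    show "computes (\<lambda>z. Cell (fst z) (snd z)) (\<lambda>z. gate_step S (fst z) (snd z))"
      by (intro computes_gate_step computes_fst_snd)
    fix g st
    show "length (unslist (car (gate_step S g st))) = length (unslist (car st))"
      by (simp add: gate_step_def)
    show "length (unslist (car st)) \<le> size st"
      using length_unslist_le[of "car st"] size_car_cdr[of st] by simp
    \<comment> \<open>The 4 counts the three \<open>Cell\<close>s of the rebuilt tuple, which are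
      new if \<open>st\<close> is malformed, and the one that appends the ciphertext;
      \<open>q\<close> bounds the ciphertext itself.\<close>
    show "size (gate_step S g st) \<le> size st + size g + poly (q + [:4:]) (length (unslist (car st)))"
      using size_car_cdr[of st] size_car_cdr[of "cdr st"] size_car_cdr[of "cdr (cdr st)"]
        q[of g "length (unslist (car st))" "car (cdr st)" "car (cdr (cdr st))" "cdr (cdr (cdr st))"]
      by (simp add: gate_step_def size_slist_snoc)
  qed
qed

text \<open>Phrased with operations that have closure rules: the total \<open>gate_step\<close>
  replaces \<open>eval_gate\<close>, and the head of the reversed list replaces
  \<open>last\<close>.\<close>

definition machine_view :: "nat \<Rightarrow> sexp \<Rightarrow> sexp \<Rightarrow> sexp \<Rightarrow> bool list \<Rightarrow> sexp" where
  "machine_view n pk evk c r =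
     (let vs = slist (noise P n r);
          st = fold (gate_step S) (unslist (slist (map enc_gate (circuit P n))))
            (Cell (unary n) (Cell evk (Cell (slist (unslist (slist (model P n)) @ unslist vs)) (Cell c Null))));
          ws = cdr (cdr (cdr st))
      in slist [unary n, pk, evk, c, server_descr P n, bits r, vs, ws, car (slist (rev (unslist ws)))])"

text \<open>Operand indices are guaranteed to be in range only for coin strings of the prescribed
  length; elsewhere the total interpreter need not agree with \<open>!\<close>.\<close>

lemma machine_view_eq:
  assumes "length r = ncoins P n"
  shows "machine_view n pk evk c r = view S P n pk evk c r"
proof -
  have "\<forall>j < length (circuit P n). wf_gate (Suc j) (length (model P n @ noise P n r)) (circuit P n ! j)"
    using server assms unfolding inference_server_def by blast
  from fold_gate_step[OF this, of S n evk c]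
  have *: "fold (gate_step S) (map enc_gate (circuit P n))
      (Cell (unary n) (Cell evk (Cell (slist (model P n @ noise P n r)) (Cell c Null)))) =
    circuit_state n evk (model P n @ noise P n r)
      (eval_circuit S n evk (model P n @ noise P n r) (circuit P n) c)"
    by (simp add: circuit_state_def)
  have car_rev: "car (slist (rev ws)) = last ws" if "ws \<noteq> []" for ws
    using that by (cases ws rule: rev_cases) simp_all
  have "eval_circuit S n evk vs gs c \<noteq> []" for vs gs
    using length_eval_circuit[of S n evk vs gs c] by auto
  then show ?thesis
    by (simp add: machine_view_def view_def Let_def * car_rev) (simp add: circuit_state_def car_rev)
qed

lemma computes_machine_view:
  assumes "computes E (\<lambda>i. unary (n i))" "computes E pk" "computes E evk" "computes E c"
    "computes E (\<lambda>i. bits (r i))"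
  shows "computes E (\<lambda>i. machine_view (n i) (pk i) (evk i) (c i) (r i))"
  unfolding machine_view_def Let_def slist_simps
  by (intro computes_Cell computes_car computes_cdr computes_Null computes_rev computes_fold_gate_step
      computes_append computes_descr computes_noise computes_server_descr assms)

lemma efficient_view:
  assumes "computes E (\<lambda>i. unary (n i))" "computes E pk" "computes E evk" "computes E c"
  shows "efficient E (\<lambda>i. spmf_of_pmf
    (map_pmf (view S P (n i) (pk i) (evk i) (c i)) (random_bits (ncoins P (n i)))))"
proof -
  have "efficient E (\<lambda>i. bind_spmf (spmf_of_pmf (random_bits (ncoins P (n i))))
    (\<lambda>r. return_spmf (machine_view (n i) (pk i) (evk i) (c i) r)))"
    by (rule efficient_let[OF efficient_random_bits[OF computes_descr(3)[OF assms(1)]] refl], fold computes_def)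
      (intro computes_machine_view computes_weaken[of E] computes_CellD(1)[OF computes_input] assms)
  moreover have "bind_spmf (spmf_of_pmf (random_bits (ncoins P (n i))))
      (\<lambda>r. return_spmf (machine_view (n i) (pk i) (evk i) (c i) r)) =
    spmf_of_pmf (map_pmf (view S P (n i) (pk i) (evk i) (c i)) (random_bits (ncoins P (n i))))" for i
    by (simp add: bind_spmf_of_pmf map_pmf_def spmf_of_pmf_bind)
      (auto intro!: bind_pmf_cong simp: set_random_bits machine_view_eq)
  ultimately show ?thesis by simp
qed

end

section \<open>Messages chosen by the attacker\<close>

text \<open>\<open>Null\<close> serves as padding because it reads as 0 at every precision.\<close>

definition pad_vec :: "nat \<Rightarrow> sexp \<Rightarrow> sexp" where
  "pad_vec M v = slist (unslist v @ replicate (M - length (unslist v)) Null)"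

lemma length_read_vec [simp]: "length (read_vec p v) = length (unslist v)"
  by (simp add: read_vec_def)

lemma read_vec_pad_vec: "read_vec p (pad_vec M v) = pad M (read_vec p v)"
  by (simp add: read_vec_def pad_vec_def pad_def)

lemma length_pad: "length x \<le> M \<Longrightarrow> length (pad M x) = M"
  by (simp add: pad_def)

text \<open>Subtraction is done on lists: dropping as many entries from the unary numeral as
  \<open>v i\<close> has leaves exactly the \<open>Null\<close> entries to append.\<close>

lemma computes_pad_vec:
  assumes "computes E (\<lambda>i. unary (M i))" "computes E v"
  shows "computes E (\<lambda>i. pad_vec (M i) (v i))"
proof -
  have "computes E (\<lambda>i. slist (unslist (v i) @
      unslist (slist (drop (length (unslist (v i))) (unslist (unary (M i)))))))"
    by (intro computes_append computes_drop assms)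
  then show ?thesis by (simp add: pad_vec_def unary_def)
qed

text \<open>After one entry is prepended and \<open>d i\<close> entries are dropped, exactly one is
  left iff the lengths agree. Without the extra entry, a list that is too short would look like one
  of the right length.\<close>

lemma computes_if_length:
  assumes "computes E v" "computes E (\<lambda>i. unary (d i))" "computes E f" "computes E g"
  shows "computes E (\<lambda>i. if length (unslist (v i)) = d i then f i else g i)"
proof -
  define w where "w = (\<lambda>i. slist (drop (length (unslist (unary (d i)))) (unslist (Cell Null (v i)))))"
  have "computes E w"
    unfolding w_def by (intro computes_drop computes_Cell computes_Null assms)
  then have "computes E (\<lambda>i. if w i \<noteq> Null then if cdr (w i) \<noteq> Null then g i else f i else g i)"
    by (intro computes_if computes_cdr assms)
  also have "(\<lambda>i. if w i \<noteq> Null then if cdr (w i) \<noteq> Null then g i else f i else g i) =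
    (\<lambda>i. if length (unslist (v i)) = d i then f i else g i)"
  proof
    fix i
    have "length (drop (d i) (Null # unslist (v i))) = Suc (length (unslist (v i))) - d i" by simp
    moreover have "slist xs = Null \<longleftrightarrow> xs = []" "cdr (slist xs) = Null \<longleftrightarrow> length xs \<le> 1" for xs
      by (cases xs rule: remdups_adj.cases; simp)+
    ultimately show "(if w i \<noteq> Null then if cdr (w i) \<noteq> Null then g i else f i else g i) =
        (if length (unslist (v i)) = d i then f i else g i)"
      unfolding w_def by (auto simp del: drop_eq_Nil length_drop simp flip: length_0_conv)
  qed
  finally show ?thesis .
qed

text \<open>
  The second component marks admissible choices, so that the second stage of the reduction
  recognises inadmissible ones even if there are no slots.
\<close>

definition pad_choice :: "nat \<Rightarrow> nat \<Rightarrow> sexp \<Rightarrow> sexp" where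
  "pad_choice d M y =
     (if length (unslist (car (car y))) = d
      then if length (unslist (cdr (car y))) = d
        then Cell (Cell (pad_vec M (car (car y))) (pad_vec M (cdr (car y)))) (Cell Null (cdr y))
        else Null
      else Null)"

definition relaxed_view_chosen :: "fhe \<Rightarrow> server \<Rightarrow> com \<Rightarrow> com \<Rightarrow> nat \<Rightarrow> bool \<Rightarrow> sexp spmf" where
  "relaxed_view_chosen S P A1 A2 n b = do {
     (pk, evk, sk) \<leftarrow> spmf_of_pmf (keygen S n);
     y \<leftarrow> result A1 (slist [unary n, pk, evk]);
     if \<forall>b. length (choice (prec S n) b y) = idim P n
     then do {
       v \<leftarrow> spmf_of_pmf (view_under_keys S P n (pk, evk, sk) (choice (prec S n) b y));
       result A2 (Cell (cdr y) v)
     }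
     else return_spmf (sbit False)
   }"

text \<open>Only the differences agree pointwise, not the probabilities themselves, so congruence of
  \<open>bind_spmf\<close> does not apply; linearity of the integral does, the integrands being
  bounded by 1.\<close>

lemma spmf_bind_diff_cong:
  assumes "\<And>a. spmf (f a) w - spmf (g a) w = spmf (f' a) w - spmf (g' a) w"
  shows "spmf (bind_spmf p f) w - spmf (bind_spmf p g) w =
    spmf (bind_spmf p f') w - spmf (bind_spmf p g') w"
proof -
  have int: "integrable (measure_spmf p) (\<lambda>a. spmf (h a) w)" for h
    by (rule measure_spmf.integrable_const_bound[where B = 1]) (simp_all add: pmf_le_1)
  show ?thesis
    by (simp add: spmf_bind int assms flip: Bochner_Integration.integral_diff)
qed

text \<open>Equal choices contribute the same to both experiments, so nothing is lost by admitting them.\<close>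

lemma view_chosen_diff:
  "spmf (view_chosen S P A1 A2 n False) w - spmf (view_chosen S P A1 A2 n True) w =
   spmf (relaxed_view_chosen S P A1 A2 n False) w - spmf (relaxed_view_chosen S P A1 A2 n True) w"
  unfolding view_chosen_def relaxed_view_chosen_def
  by (rule spmf_bind_diff_cong, clarsimp, rule spmf_bind_diff_cong) auto

section \<open>The reductions to IND-CPA\<close>

context inference
begin

lemma view_reduction:
  assumes "ppt A"
  obtains B where "ppt B"
    "\<And>n pk evk c. result B (slist [unary n, pk, evk, c]) =
      bind_spmf (spmf_of_pmf (map_pmf (view S P n pk evk c) (random_bits (ncoins P n)))) (result A)"
proof -
  let ?D = "\<lambda>x. spmf_of_pmf (map_pmf
    (view S P (length (unslist (car x))) (car (cdr x)) (car (cdr (cdr x))) (car (cdr (cdr (cdr x)))))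
    (random_bits (ncoins P (length (unslist (car x))))))"
  have "efficient (\<lambda>x. x) ?D"
    by (intro efficient_view computes_length computes_car computes_cdr computes_input)
  from efficient_bind[OF this _ ppt_imp_efficient[OF assms], of ?D]
  have "efficient (\<lambda>x. x) (\<lambda>x. bind_spmf (?D x) (result A))" by (simp add: spmf.map_ident)
  then obtain B where B: "ppt B" "result B = (\<lambda>x. bind_spmf (?D x) (result A))"
    by (rule efficient_imp_ppt)
  show ?thesis by (rule that[OF B(1)]) (simp add: B(2))
qed

lemma choice_reduction:
  assumes "ppt A"
  obtains B where "ppt B"
    "\<And>n pk evk. result B (slist [unary n, pk, evk]) =
      map_spmf (pad_choice (idim P n) (slots S n)) (result A (slist [unary n, pk, evk]))"
proof -
  let ?n = "\<lambda>x. length (unslist (car x))"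
  have "efficient (\<lambda>x. x) (\<lambda>x. bind_spmf (result A x)
    (\<lambda>y. return_spmf (pad_choice (idim P (?n x)) (slots S (?n x)) y)))"
    unfolding pad_choice_def
    by (rule efficient_let[OF ppt_imp_efficient[OF assms], where E' = "\<lambda>y. y"],
        simp add: spmf.map_ident, fold computes_def)
      (intro computes_if_length computes_Cell computes_Null computes_car computes_cdr computes_fst_snd
        computes_pad_vec computes_descr computes_slots computes_length)
  then obtain B where B: "ppt B" "result B = (\<lambda>x. bind_spmf (result A x)
    (\<lambda>y. return_spmf (pad_choice (idim P (?n x)) (slots S (?n x)) y)))"
    by (rule efficient_imp_ppt)
  show ?thesis by (rule that[OF B(1)]) (simp add: B(2) map_spmf_conv_bind_spmf)
qed

text \<open>The marker decides: the state passed on is \<open>Cell Null st\<close> after an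
  admissible choice and \<open>Null\<close> otherwise. The answer \<open>Null\<close> is
  \<open>sbit False\<close>, the verdict of the view experiment on inadmissible choices.\<close>

lemma chosen_view_reduction:
  assumes "ppt A"
  obtains B where "ppt B"
    "\<And>x. result B (Cell Null x) = return_spmf Null"
    "\<And>st n pk evk c. result B (Cell (Cell Null st) (slist [unary n, pk, evk, c])) =
      bind_spmf (spmf_of_pmf (map_pmf (view S P n pk evk c) (random_bits (ncoins P n))))
        (\<lambda>v. result A (Cell st v))"
proof -
  let ?D = "\<lambda>x. spmf_of_pmf (map_pmf
    (view S P (length (unslist (car (cdr x)))) (car (cdr (cdr x))) (car (cdr (cdr (cdr x))))
      (car (cdr (cdr (cdr (cdr x)))))) (random_bits (ncoins P (length (unslist (car (cdr x)))))))"
  have D: "efficient (\<lambda>x. x) ?D"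
    by (intro efficient_view computes_length computes_car computes_cdr computes_input)
  have G: "efficient (\<lambda>z. Cell (fst z) (snd z)) (\<lambda>z. result A (Cell (cdr (car (snd z))) (fst z)))"
    by (rule efficient_compose[of _ "\<lambda>z. Cell (cdr (car (snd z))) (fst z)"])
      (intro computes_Cell computes_car computes_cdr computes_fst_snd,
        rule efficient_reindex[OF ppt_imp_efficient[OF assms]])
  have "efficient (\<lambda>x. x) (\<lambda>x. bind_spmf (?D x) (\<lambda>v. result A (Cell (cdr (car x)) v)))"
    by (rule efficient_let[where E' = "\<lambda>y. y", OF D _ G]) (simp add: spmf.map_ident)
  then have "efficient (\<lambda>x. x) (\<lambda>x. if car x \<noteq> Null
      then bind_spmf (?D x) (\<lambda>v. result A (Cell (cdr (car x)) v)) else return_spmf Null)"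
    by (intro efficient_if computes_car computes_input computes_Null[unfolded computes_def])
  then obtain B where B: "ppt B" "result B = (\<lambda>x. if car x \<noteq> Null
      then bind_spmf (?D x) (\<lambda>v. result A (Cell (cdr (car x)) v)) else return_spmf Null)"
    by (rule efficient_imp_ppt)
  show ?thesis by (rule that[OF B(1)]) (simp_all add: B(2))
qed

lemma idim_le_slots: "idim P n \<le> slots S n"
  using server by (simp add: inference_server_def)

text \<open>Keys and ciphertext come from the same distribution on both sides, and \<open>B\<close>
  tosses the server's coins itself, so the experiments coincide exactly.\<close>

lemma pr_one_server_view:
  assumes "\<And>n pk evk c. result B (slist [unary n, pk, evk, c]) =
      bind_spmf (spmf_of_pmf (map_pmf (view S P n pk evk c) (random_bits (ncoins P n)))) (result A)"
  shows "pr_one A (server_view S P n x) = pr_one B (cpa_input S n (pad (slots S n) x))"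
proof -
  have "bind_pmf (server_view S P n x) (result A) = bind_pmf (cpa_input S n (pad (slots S n) x)) (result B)"
    unfolding server_view_def cpa_input_def
    unfolding bind_assoc_pmf
    by (rule bind_pmf_cong[OF refl], clarify)
      (simp add: bind_assoc_pmf bind_return_pmf assms view_under_keys_eq del: slist_simps)
  then show ?thesis by (simp add: pr_one_def bind_spmf_of_pmf)
qed

lemma choice_pad_choice:
  assumes "\<forall>b. length (choice p b y) = d"
  shows "choice p b (pad_choice d M y) = pad M (choice p b y)" "cdr (pad_choice d M y) = Cell Null (cdr y)"
  using assms[rule_format, of True] assms[rule_format, of False]
  by (simp_all add: choice_def pad_choice_def read_vec_pad_vec)

lemma pad_choice_inadmissible: "\<not> (\<forall>b. length (choice p b y) = d) \<Longrightarrow> pad_choice d M y = Null"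
  by (auto simp: choice_def pad_choice_def all_bool_eq)

lemma relaxed_view_chosen_eq:
  assumes B1: "\<And>n pk evk. result B1 (slist [unary n, pk, evk]) =
      map_spmf (pad_choice (idim P n) (slots S n)) (result A1 (slist [unary n, pk, evk]))"
    and B2_Null: "\<And>x. result B2 (Cell Null x) = return_spmf Null"
    and B2: "\<And>st n pk evk c. result B2 (Cell (Cell Null st) (slist [unary n, pk, evk, c])) =
      bind_spmf (spmf_of_pmf (map_pmf (view S P n pk evk c) (random_bits (ncoins P n))))
        (\<lambda>v. result A2 (Cell st v))"
  shows "cpa_chosen S B1 B2 n b = relaxed_view_chosen S P A1 A2 n b"
proof -
  have "(if \<forall>b. length (choice (prec S n) b (pad_choice (idim P n) (slots S n) y)) = slots S n
     then do {
       c \<leftarrow> spmf_of_pmf (enc S n pk (choice (prec S n) b (pad_choice (idim P n) (slots S n) y)));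
       result B2 (Cell (cdr (pad_choice (idim P n) (slots S n) y)) (slist [unary n, pk, evk, c]))
     }
     else return_spmf (sbit False)) =
    (if \<forall>b. length (choice (prec S n) b y) = idim P n
     then do {
       v \<leftarrow> spmf_of_pmf (view_under_keys S P n (pk, evk, sk) (choice (prec S n) b y));
       result A2 (Cell (cdr y) v)
     }
     else return_spmf (sbit False))" for pk evk sk y
  proof (cases "\<forall>b. length (choice (prec S n) b y) = idim P n")
    case True
    then show ?thesis
      by (simp add: choice_pad_choice[OF True] length_pad idim_le_slots B2 view_under_keys_eq
          bind_assoc_pmf del: slist_simps)
  next
    case False
    \<comment> \<open>\<open>Null\<close> reads as two empty vectors. If there are slots, the CPA
      experiment rejects these itself; if there are none, it goes on and \<open>B2\<close> answers
      \<open>Null\<close>, which is \<open>sbit False\<close> as well.\<close>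
    show ?thesis
      unfolding if_not_P[OF False] pad_choice_inadmissible[OF False]
      by (simp add: B2_Null sbit_def del: slist_simps)
  qed
  then show ?thesis
    unfolding cpa_chosen_def relaxed_view_chosen_def B1 bind_map_spmf o_def by simp
qed

end

theorem theorem1:
  fixes S :: fhe and P :: server
  assumes "fhe_scheme S"
    and "ind_cpa S"
    and "inference_server S P"
  shows "(\<forall>A x x'. ppt A \<longrightarrow>
            (\<forall>n. length (x n) = idim P n \<and> length (x' n) = idim P n \<and> x n \<noteq> x' n) \<longrightarrow>
            negligible_fun (\<lambda>n. \<bar>pr_one A (server_view S P n (x n)) -
                             pr_one A (server_view S P n (x' n))\<bar>)) \<and>
         (\<forall>A1 A2. ppt A1 \<longrightarrow> ppt A2 \<longrightarrow>
            negligible_fun (\<lambda>n. \<bar>spmf (view_chosen S P A1 A2 n False) (sbit True) -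
                             spmf (view_chosen S P A1 A2 n True) (sbit True)\<bar>))"
proof -
  interpret inference S P using assms by unfold_locales
  show ?thesis
  proof (intro conjI allI impI)
    fix A and x x' :: "nat \<Rightarrow> real list"
    assume A: "ppt A" and x: "\<forall>n. length (x n) = idim P n \<and> length (x' n) = idim P n \<and> x n \<noteq> x' n"
    from A obtain B where B: "ppt B" "\<And>n pk evk c. result B (slist [unary n, pk, evk, c]) =
      bind_spmf (spmf_of_pmf (map_pmf (view S P n pk evk c) (random_bits (ncoins P n)))) (result A)"
      by (rule view_reduction) blast
    \<comment> \<open>The fixed inputs are arbitrary reals without a machine representation, so
      padding is applied to the messages themselves and not by the adversary.\<close>
    let ?m = "\<lambda>n. pad (slots S n) (x n)" and ?m' = "\<lambda>n. pad (slots S n) (x' n)"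
    have "negligible_fun (\<lambda>n. \<bar>pr_one B (cpa_input S n (?m n)) - pr_one B (cpa_input S n (?m' n))\<bar>)"
      by (rule assms(2)[unfolded ind_cpa_def, THEN conjunct1, rule_format, OF B(1)])
        (use x in \<open>simp_all add: length_pad idim_le_slots\<close>)
    then show "negligible_fun (\<lambda>n. \<bar>pr_one A (server_view S P n (x n)) - pr_one A (server_view S P n (x' n))\<bar>)"
      by (simp add: pr_one_server_view[OF B(2)])
  next
    fix A1 A2 assume A: "ppt A1" "ppt A2"
    from A(1) obtain B1 where B1: "ppt B1" "\<And>n pk evk. result B1 (slist [unary n, pk, evk]) =
      map_spmf (pad_choice (idim P n) (slots S n)) (result A1 (slist [unary n, pk, evk]))"
      by (rule choice_reduction) blast
    from A(2) obtain B2 where B2: "ppt B2"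
      "\<And>x. result B2 (Cell Null x) = return_spmf Null"
      "\<And>st n pk evk c. result B2 (Cell (Cell Null st) (slist [unary n, pk, evk, c])) =
        bind_spmf (spmf_of_pmf (map_pmf (view S P n pk evk c) (random_bits (ncoins P n))))
          (\<lambda>v. result A2 (Cell st v))"
      by (rule chosen_view_reduction) blast
    have "negligible_fun (\<lambda>n. \<bar>spmf (cpa_chosen S B1 B2 n False) (sbit True) -
        spmf (cpa_chosen S B1 B2 n True) (sbit True)\<bar>)"
      using assms(2) B1(1) B2(1) unfolding ind_cpa_def by blast
    then show "negligible_fun (\<lambda>n. \<bar>spmf (view_chosen S P A1 A2 n False) (sbit True) -
        spmf (view_chosen S P A1 A2 n True) (sbit True)\<bar>)"
      by (simp add: relaxed_view_chosen_eq[OF B1(2) B2(2,3)] view_chosen_diff)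
  qed
qed

end
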